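(* Let $\alpha,\beta$ be compositions of the same length $R$ and size $N$ with $\alpha\neq(1^R)$, and $\nu$ a partition of $N$. Suppose that $r_\alpha-r_\beta=s_\nu$ and $\lambda(\alpha)\neq\lambda(\beta)$. Then $\nu=ab1^d$ for some $a,b,d$, and there exist $\tilde\alpha\in\{\alpha,\alpha^*\}$, $\tilde\beta\in\{\beta,\beta^*\}$ such that either $\tilde\alpha=(b,1^d,a)$ and $\tilde\beta=(b-1,1^d,a+1)$, or $\tilde\alpha=(a,b,1^d)$ and $\tilde\beta=(b-1,a+1,1^d)$.
   Context: A composition is a finite sequence of positive integers; $j^m$ denotes $m$ consecutive parts equal to $j$; $\alpha^*$ is the reverse of $\alpha$; $\lambda(\alpha)$ is the partition obtained by sorting the parts of $\alpha$ decreasingly. $ab1^d$ denotes the partition $(a,b,1,\dots,1)$ with $d$ ones. The ribbon diagram of $\alpha=\alpha_1\cdots\alpha_R$ (English convention, rows from the top) has $\alpha_i$ cells in row $i$, with the rightmost cell of row $i+1$ directly below the leftmost cell of row $i$; $r_\alpha=\sum_T\prod_m x_m^{\#\{m\text{'s in }T\}}$ over semistandard Young tableaux $T$ of this shape (rows weakly increasing, columns strictly increasing). $s_\nu$ is the Schur function. *)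

theory Defs
  imports Main "HOL-Library.FuncSet"
begin

section \<open>Compositions and partitions\<close>

definition composition :: "nat list \<Rightarrow> bool" where
  "composition \<alpha> \<longleftrightarrow> (\<forall>x\<in>set \<alpha>. 0 < x)"

definition int_partition :: "nat list \<Rightarrow> bool" where
  "int_partition \<nu> \<longleftrightarrow> composition \<nu> \<and> sorted_wrt (\<ge>) \<nu>"

definition sorted_parts :: "nat list \<Rightarrow> nat list" where
  "sorted_parts \<alpha> = rev (sort \<alpha>)"

section \<open>Diagrams\<close>

text \<open>A cell is a pair (row, column), both counted from 0, rows downwards and columns
  to the right (English convention).\<close>

type_synonym cell = "nat \<times> nat"

definition young_diagram :: "nat list \<Rightarrow> cell set" where
  "young_diagram \<nu> = {(i, j). i < length \<nu> \<and> j < \<nu> ! i}"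

text \<open>The column of the leftmost cell of row \<open>i\<close>, normalised so that the bottom row starts in
  column 0. Consecutive rows overlap in one column, so every row \<open>k\<close> below row \<open>i\<close> shifts it
  by \<open>\<alpha> ! k - 1\<close>.\<close>

definition ribbon_start :: "nat list \<Rightarrow> nat \<Rightarrow> nat" where
  "ribbon_start \<alpha> i = (\<Sum>k\<in>{i<..<length \<alpha>}. \<alpha> ! k - 1)"

definition ribbon_diagram :: "nat list \<Rightarrow> cell set" where
  "ribbon_diagram \<alpha> =
     {(i, j). i < length \<alpha> \<and> ribbon_start \<alpha> i \<le> j \<and> j < ribbon_start \<alpha> i + \<alpha> ! i}"

lemma ribbon_rows_overlap:
  assumes "composition \<alpha>" and "Suc i < length \<alpha>"
  shows "ribbon_start \<alpha> (Suc i) + \<alpha> ! Suc i - 1 = ribbon_start \<alpha> i"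
proof -
  have "{i<..<length \<alpha>} = insert (Suc i) {Suc i<..<length \<alpha>}"
    using assms(2) by auto
  moreover have "0 < \<alpha> ! Suc i"
    using assms by (auto simp: composition_def)
  ultimately show ?thesis
    by (simp add: ribbon_start_def)
qed

section \<open>Semistandard tableaux and their generating functions\<close>

text \<open>The entries are the positive integers. Extensionality (\<open>\<rightarrow>\<^sub>E\<close>) makes a tableau be
  determined by its entries on the diagram, so that tableaux may be counted.\<close>

definition ssyt :: "cell set \<Rightarrow> (cell \<Rightarrow> nat) set" where
  "ssyt D = {T \<in> D \<rightarrow>\<^sub>E {1..}.
     (\<forall>i j j'. (i, j) \<in> D \<and> (i, j') \<in> D \<and> j < j' \<longrightarrow> T (i, j) \<le> T (i, j')) \<and>
     (\<forall>i i' j. (i, j) \<in> D \<and> (i', j) \<in> D \<and> i < i' \<longrightarrow> T (i, j) < T (i', j))}"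

definition tableau_content :: "cell set \<Rightarrow> (cell \<Rightarrow> nat) \<Rightarrow> nat \<Rightarrow> nat" where
  "tableau_content D T m = card {c \<in> D. T c = m}"

text \<open>A formal power series in \<open>x\<^sub>1, x\<^sub>2, \<dots>\<close> with integer coefficients is represented by its
  coefficient function: the exponent vector \<open>e\<close> stands for the monomial \<open>\<Prod>\<^sub>m x\<^sub>m ^ e m\<close>.
  Vectors \<open>e\<close> of infinite support or with \<open>e 0 \<noteq> 0\<close> are no monomials; the series below are 0
  there, as the diagrams are finite and the entries positive. Differences of series are the
  pointwise differences of functions.\<close>

type_synonym series = "(nat \<Rightarrow> nat) \<Rightarrow> int"

definition tableau_series :: "cell set \<Rightarrow> series" where
  "tableau_series D e = int (card {T \<in> ssyt D. tableau_content D T = e})"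

definition ribbon_schur :: "nat list \<Rightarrow> series" where
  "ribbon_schur \<alpha> = tableau_series (ribbon_diagram \<alpha>)"

definition schur :: "nat list \<Rightarrow> series" where
  "schur \<nu> = tableau_series (young_diagram \<nu>)"

text \<open>The cardinality in the definition of \<open>tableau_series\<close> is that of a finite set.\<close>

lemma finite_young_diagram: "finite (young_diagram \<nu>)"
proof -
  have "young_diagram \<nu> = Sigma {..<length \<nu>} (\<lambda>i. {..<\<nu> ! i})"
    by (auto simp: young_diagram_def)
  then show ?thesis by simp
qed

lemma finite_ribbon_diagram: "finite (ribbon_diagram \<alpha>)"
proof -
  have "ribbon_diagram \<alpha> =
      Sigma {..<length \<alpha>} (\<lambda>i. {ribbon_start \<alpha> i..<ribbon_start \<alpha> i + \<alpha> ! i})"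
    by (auto simp: ribbon_diagram_def)
  then show ?thesis by simp
qed

lemma finite_tableaux_with_content:
  assumes "finite D"
  shows "finite {T \<in> ssyt D. tableau_content D T = e}"
proof (cases "\<exists>T. tableau_content D T = e")
  case True
  then obtain T0 where T0: "tableau_content D T0 = e" by blast
  have *: "{m. tableau_content D T m \<noteq> 0} = T ` D" for T
    using assms by (auto simp: tableau_content_def card_eq_0_iff)
  have "{T \<in> ssyt D. tableau_content D T = e} \<subseteq> D \<rightarrow>\<^sub>E (T0 ` D)"
  proof
    fix T assume T: "T \<in> {T \<in> ssyt D. tableau_content D T = e}"
    then have "T ` D = T0 ` D"
      using *[of T] *[of T0] T0 by simp
    with T show "T \<in> D \<rightarrow>\<^sub>E (T0 ` D)"
      by (auto simp: ssyt_def PiE_iff)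
  qed
  moreover have "finite (D \<rightarrow>\<^sub>E (T0 ` D))"
    using assms by (intro finite_PiE) auto
  ultimately show ?thesis by (rule finite_subset)
next
  case False
  then have "{T \<in> ssyt D. tableau_content D T = e} = {}" by blast
  then show ?thesis by (simp only: finite.emptyI)
qed

end

theory Submission
  imports Defs Complex_Main "HOL-Library.Multiset"
begin

text \<open>Peel a diagram letter by letter, allowing besides ordinary letters, whose cells form horizontal
  strips, also primed letters, whose cells form vertical strips. By \<open>\<Sum>\<^sub>j (-1)\<^sup>j h\<^sub>j e\<^sub>k\<^sub>-\<^sub>j = 0\<close> a linear
  relation between tableau series persists for words containing primed letters. A primed letter of
  multiplicity \<open>R\<close> removes the first column of \<open>\<nu>\<close> and the first cell of every row of a ribbon of
  length \<open>R\<close>, which leaves disjoint rows. Comparing the disjoint rows yields \<open>\<nu> = ab1\<^sup>d\<close> and the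
  parts of \<open>\<alpha>\<close> and \<open>\<beta>\<close>. A primed letter of multiplicity \<open>R - 1\<close> misses one row; counting what remains
  in two ordinary letters shows which parts stand at the ends of \<open>\<alpha>\<close> and \<open>\<beta>\<close>, and a further
  primed letter of multiplicity 3 counts their blocks of ones.\<close>

section \<open>Diagrams peeled by words of ordinary and primed letters\<close>

text \<open>For an ordinary word \<open>cnt\<close> is a coefficient of the tableau series, that is,
  the pairing with a product of complete symmetric functions \<open>h\<close>. A primed letter
  replaces a factor \<open>h\<close> by an elementary one \<open>e\<close>, a polynomial in the
  \<open>h\<close>'s. Words make this available without proving that the series are symmetric. The
  obstacle: without its first cells a ribbon forgets the order of its parts, so this yields
  multisets only. If row r keeps its first cell, one overlap survives, with row r + 1, and the
  number of fillings by two letters is the product of the parts times 1 - 1/\<alpha>_(r+1), or times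
  1 + 1/\<alpha>_r if r is the last row. Summed over r, the multiset determines everything except
  1/first + 1/last. Essentially two configurations survive: both large parts at the ends, or one at
  an end and one inside. In the second case the two must be shown to be adjacent. The primed letter
  of multiplicity 3 forces the omitted row to close a block of ones, so it counts the blocks. This
  needs two parts of \<beta> above 1; if b = 2 there is only one, and column heights take
  over.\<close>

definition before :: "cell \<Rightarrow> cell \<Rightarrow> bool" where
  "before c d \<longleftrightarrow> (fst c = fst d \<and> snd c < snd d) \<or> (snd c = snd d \<and> fst c < fst d)"

text \<open>Closure under the comparisons \<open>before\<close> is closure under the order that they
  generate, so transitivity never has to be discussed.\<close>

definition initial :: "cell set \<Rightarrow> cell set \<Rightarrow> bool" where
  "initial D A \<longleftrightarrow> A \<subseteq> D \<and> (\<forall>c\<in>A. \<forall>d\<in>D. before d c \<longrightarrow> d \<in> A)"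

definition strip :: "bool \<Rightarrow> cell set \<Rightarrow> bool" where
  "strip s A \<longleftrightarrow> (if s then inj_on snd A else inj_on fst A)"

definition strips :: "bool \<Rightarrow> nat \<Rightarrow> cell set \<Rightarrow> cell set set" where
  "strips s m D = {A. initial D A \<and> card A = m \<and> strip s A}"

text \<open>A letter is a pair of a flag, \<open>True\<close> for an ordinary and \<open>False\<close> for a primed letter, and its
  multiplicity; letters increase along the word.\<close>

primrec cnt :: "(bool \<times> nat) list \<Rightarrow> cell set \<Rightarrow> int" where
  "cnt [] D = (if D = {} then 1 else 0)"
| "cnt (l # w) D = (\<Sum>A\<in>strips (fst l) (snd l) D. cnt w (D - A))"

lemma strips_subset: "A \<in> strips s m D \<Longrightarrow> A \<subseteq> D"
  by (simp add: strips_def initial_def)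

lemma finite_strips: "finite D \<Longrightarrow> finite (strips s m D)"
  by (rule finite_subset[of _ "Pow D"]) (auto dest: strips_subset)

lemma cnt_nonneg: "0 \<le> cnt w D"
  by (induction w arbitrary: D) (auto intro: sum_nonneg)

lemma strips_0: "finite D \<Longrightarrow> strips s 0 D = {{}}"
  by (auto simp: strips_def initial_def strip_def dest: finite_subset)

lemma cnt_append_cong:
  assumes "\<And>D. finite D \<Longrightarrow> cnt w D = cnt w' D" "finite D"
  shows "cnt (u @ w) D = cnt (u @ w') D"
  using assms(2) by (induction u arbitrary: D) (auto simp: assms(1) intro!: sum.cong)

text \<open>Removes the empty letters at the two ends of the alternating sum, where one of the two
  strips has no cells.\<close>

lemma cnt_0: "finite D \<Longrightarrow> cnt (u @ (s, 0) # w) D = cnt (u @ w) D"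
  by (rule cnt_append_cong) (simp_all add: strips_0)

text \<open>The involution toggles the rightmost cell of the topmost row of the union of the two strips.\<close>

definition corner :: "cell set \<Rightarrow> cell" where
  "corner C = (Min (fst ` C), Max {j. (Min (fst ` C), j) \<in> C})"

definition toggle :: "cell set \<times> cell set \<Rightarrow> cell set \<times> cell set" where
  "toggle = (\<lambda>(A, B). let c = corner (A \<union> B)
     in if c \<in> A then (A - {c}, insert c B) else (insert c A, B - {c}))"

definition strip_pairs :: "nat \<Rightarrow> cell set \<Rightarrow> (cell set \<times> cell set) set" where
  "strip_pairs k D = {(A, B). initial D A \<and> strip True A \<and> initial (D - A) B \<and> strip False B
     \<and> card A + card B = k}"

lemma corner_cell:
  fixes C :: "cell set"
  assumes "finite C" "C \<noteq> {}"
  defines "c \<equiv> corner C"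
  shows "c \<in> C"
    "\<And>d. d \<in> C \<Longrightarrow> fst c \<le> fst d" "\<And>d. d \<in> C \<Longrightarrow> fst d = fst c \<Longrightarrow> snd d \<le> snd c"
proof -
  let ?i = "Min (fst ` C)"
  have "?i \<in> fst ` C" using assms by simp
  then have ne: "{j. (?i, j) \<in> C} \<noteq> {}" by force
  have fin: "finite {j. (?i, j) \<in> C}"
    by (rule finite_subset[of _ "snd ` C"]) (use assms in force)+
  show 1: "c \<in> C" using Max_in[OF fin ne] by (simp add: c_def corner_def)
  show "fst c \<le> fst d" if "d \<in> C" for d using that assms by (simp add: c_def corner_def)
  show 4: "snd d \<le> snd c" if "d \<in> C" "fst d = fst c" for d
  proof -
    have "snd d \<in> {j. (?i, j) \<in> C}" using that by (simp add: c_def corner_def) (metis prod.collapse)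
    then show ?thesis using fin by (simp add: c_def corner_def)
  qed
qed

text \<open>Let c be the corner. If c lies in A, nothing of A follows it: to the right by its
  choice, below because A has one cell per column. Another cell of B in its row would lie to its
  left, hence in A. If c lies in B, all cells before it lie in A: B has one cell per row, and no row
  above meets the union. A cell of A below c would force c into A.\<close>

lemma toggle_strip_pairs:
  assumes "finite D" "0 < k" "p \<in> strip_pairs k D"
  shows "toggle p \<in> strip_pairs k D" "toggle (toggle p) = p"
    "(-1::int) ^ card (fst (toggle p)) = - ((-1) ^ card (fst p))"
proof -
  obtain A B where p: "p = (A, B)" by force
  define C where "C = A \<union> B"
  define c where "c = corner C"
  have AD: "A \<subseteq> D" "B \<subseteq> D" "A \<inter> B = {}"
    using assms(3) by (auto simp: p strip_pairs_def initial_def)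
  have fin: "finite A" "finite B" "finite C" using AD assms(1) by (auto simp: C_def dest: finite_subset)
  have "C \<noteq> {}" using assms(2,3) by (auto simp: C_def p strip_pairs_def)
  note cc = corner_cell[OF fin(3) this, folded c_def]
  have iA: "\<And>x d. x \<in> A \<Longrightarrow> d \<in> D \<Longrightarrow> before d x \<Longrightarrow> d \<in> A"
    and iB: "\<And>x d. x \<in> B \<Longrightarrow> d \<in> D \<Longrightarrow> before d x \<Longrightarrow> d \<in> C"
    and sA: "inj_on snd A" and sB: "inj_on fst B" and k: "card A + card B = k"
    using assms(3) unfolding p strip_pairs_def initial_def strip_def C_def by auto
  have tog: "toggle p = (if c \<in> A then (A - {c}, insert c B) else (insert c A, B - {c}))"
    by (simp add: toggle_def p Let_def C_def c_def)
  show "toggle p \<in> strip_pairs k D"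
  proof (cases "c \<in> A")
    case True
    have "c \<notin> B" using True AD by auto
    have "d \<in> A - {c}" if "x \<in> A - {c}" "d \<in> D" "before d x" for x d
    proof -
      have "d \<noteq> c"
      proof
        assume "d = c"
        then have "snd c = snd x \<or> fst c = fst x \<and> snd c < snd x" using that(3) by (auto simp: before_def)
        then show False
          using that(1) True sA cc(3)[of x] by (auto simp: C_def inj_on_def)
      qed
      then show ?thesis using iA[of x d] that by auto
    qed
    then have 1: "initial D (A - {c})" using AD unfolding initial_def by blast
    have 2: "inj_on fst (insert c B)"
    proof -
      have "fst x \<noteq> fst c" if "x \<in> B" for x
      proof
        assume x: "fst x = fst c"
        have "x \<noteq> c" using that \<open>c \<notin> B\<close> by auto
        then have "snd x < snd c" using cc(3)[of x] that x by (cases x; cases c) (auto simp: C_def)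
        then have "before x c" using x by (simp add: before_def)
        then have "x \<in> A" using iA[of c x] True that AD by auto
        then show False using that AD by auto
      qed
      then show ?thesis using sB unfolding inj_on_insert by (metis DiffD1 imageE)
    qed
    have 3: "initial (D - (A - {c})) (insert c B)"
      unfolding initial_def
    proof (intro conjI ballI impI)
      show "insert c B \<subseteq> D - (A - {c})" using AD True by auto
      fix x d assume "x \<in> insert c B" "d \<in> D - (A - {c})" "before d x"
      then show "d \<in> insert c B" using iA[OF True, of d] iB[of x d] by (auto simp: C_def)
    qed
    have 4: "card (A - {c}) + card (insert c B) = k"
      using k True \<open>c \<notin> B\<close> fin card_Suc_Diff1[of A c] by simp
    show ?thesis unfolding tog using 1 2 3 4 sA True
      by (simp add: strip_pairs_def strip_def inj_on_diff)
  next
    case False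
    then have cB: "c \<in> B" using cc(1) by (auto simp: C_def)
    have ins: "d \<in> A" if "d \<in> D" "before d c" for d
    proof (rule ccontr)
      assume "d \<notin> A"
      then have d: "d \<in> B" using iB[OF cB that] by (auto simp: C_def)
      then have "fst d \<noteq> fst c" using that(2) sB cB by (auto simp: inj_on_def before_def)
      then have "fst d < fst c" using that(2) by (auto simp: before_def)
      then show False using cc(2)[of d] d by (auto simp: C_def)
    qed
    have 1: "initial D (insert c A)"
      using AD cB iA ins unfolding initial_def by blast
    have 2: "inj_on snd (insert c A)"
    proof -
      have "snd x \<noteq> snd c" if "x \<in> A" for x
      proof
        assume x: "snd x = snd c"
        have "x \<noteq> c" using that False by auto
        then have "fst c < fst x" using cc(2)[of x] that x by (cases x; cases c) (auto simp: C_def)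
        then have "before c x" using x by (simp add: before_def)
        then show False using iA[OF that, of c] False cB AD by auto
      qed
      then show ?thesis using sA unfolding inj_on_insert by (metis DiffD1 imageE)
    qed
    have 3: "initial (D - insert c A) (B - {c})"
      unfolding initial_def
    proof (intro conjI ballI impI)
      show "B - {c} \<subseteq> D - insert c A" using AD by auto
      fix x d assume "x \<in> B - {c}" "d \<in> D - insert c A" "before d x"
      then show "d \<in> B - {c}" using iB[of x d] by (auto simp: C_def)
    qed
    have 4: "card (insert c A) + card (B - {c}) = k"
      using k False cB fin card_Suc_Diff1[of B c] by simp
    show ?thesis unfolding tog using 1 2 3 4 sB False
      by (simp add: strip_pairs_def strip_def inj_on_diff)
  qed
  \<comment> \<open>The union is unchanged, so the second application finds the same corner and
    moves it back.\<close>
  have un: "A - {c} \<union> insert c B = C" if "c \<in> A" using that by (auto simp: C_def)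
  have un2: "insert c A \<union> (B - {c}) = C" if "c \<notin> A" using that cc(1) by (auto simp: C_def)
  have tog2: "toggle (A', B') = (if c \<in> A' then (A' - {c}, insert c B') else (insert c A', B' - {c}))"
    if "A' \<union> B' = C" for A' B'
    unfolding toggle_def Let_def c_def that[symmetric] by simp
  have cB: "c \<in> A \<longleftrightarrow> c \<notin> B" using cc(1) AD by (auto simp: C_def)
  show "toggle (toggle p) = p"
  proof (cases "c \<in> A")
    case True
    then show ?thesis unfolding tog using tog2[OF un[OF True]] cB by (auto simp: p)
  next
    case False
    then show ?thesis unfolding tog using tog2[OF un2[OF False]] cB by (auto simp: p)
  qed
  show "(-1::int) ^ card (fst (toggle p)) = - ((-1) ^ card (fst p))"
  proof (cases "c \<in> A")
    case True
    then have "card A = Suc (card (A - {c}))" using fin by (metis card_Suc_Diff1)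
    then have "(-1::int) ^ card A = - ((-1) ^ card (A - {c}))" by (simp only: power_Suc mult_minus1)
    then show ?thesis unfolding tog if_P[OF True] fst_conv by (simp only: p fst_conv minus_minus)
  next
    case False
    then show ?thesis unfolding tog using fin by (simp add: p)
  qed
qed

lemma involution_sum_zero:
  fixes f :: "'a \<Rightarrow> int"
  assumes "finite S" "\<And>x. x \<in> S \<Longrightarrow> g x \<in> S" "\<And>x. x \<in> S \<Longrightarrow> g (g x) = x"
    "\<And>x. x \<in> S \<Longrightarrow> f (g x) = - f x"
  shows "sum f S = 0"
proof -
  have "sum f S = sum (\<lambda>x. f (g x)) S"
    by (rule sum.reindex_bij_witness[of _ g g]) (use assms in auto)
  also have "\<dots> = - sum f S" using assms(4) by (simp add: sum_negf)
  finally show ?thesis by simp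
qed

text \<open>A summand depends on a pair (A, B) only through the parity of the size of A and the
  union of the two; \<open>toggle\<close> flips the first and keeps the second. Since k is positive
  the union is nonempty and has a corner.\<close>

lemma alternating_cnt_head:
  assumes "finite D" "0 < k"
  shows "(\<Sum>j\<le>k. (-1) ^ j * cnt ((True, j) # (False, k - j) # w) D) = 0"
proof -
  let ?S = "SIGMA j:{..k}. SIGMA A:strips True j D. strips False (k - j) (D - A)"
  have fin: "finite (strip_pairs k D)"
    by (rule finite_subset[of _ "Pow D \<times> Pow D"])
      (use assms in \<open>auto simp: strip_pairs_def initial_def\<close>)
  have "(\<Sum>j\<le>k. (-1) ^ j * cnt ((True, j) # (False, k - j) # w) D) =
      (\<Sum>(j, A, B)\<in>?S. (-1) ^ j * cnt w (D - A - B))"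
    using assms by (simp add: sum_distrib_left sum.Sigma finite_strips case_prod_beta)
  also have "\<dots> = (\<Sum>(A, B)\<in>strip_pairs k D. (-1) ^ card A * cnt w (D - A - B))"
    by (rule sum.reindex_bij_witness[of _ "\<lambda>(A, B). (card A, A, B)" snd])
      (auto simp: strip_pairs_def strips_def)
  also have "\<dots> = 0"
  proof (rule involution_sum_zero[OF fin])
    fix p assume p: "p \<in> strip_pairs k D"
    note t = toggle_strip_pairs[OF assms p]
    show "toggle p \<in> strip_pairs k D" "toggle (toggle p) = p" using t by auto
    have "fst (toggle p) \<union> snd (toggle p) = fst p \<union> snd p"
    proof -
      have C: "finite (fst p \<union> snd p)" "fst p \<union> snd p \<noteq> {}"
        using p assms by (auto simp: strip_pairs_def initial_def dest: finite_subset)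
      show ?thesis using corner_cell(1)[OF C] by (auto simp: toggle_def Let_def split: prod.splits)
    qed
    then have "D - fst (toggle p) - snd (toggle p) = D - fst p - snd p" by blast
    then show "(case toggle p of (A, B) \<Rightarrow> (-1) ^ card A * cnt w (D - A - B)) =
        - (case p of (A, B) \<Rightarrow> (-1) ^ card A * cnt w (D - A - B))"
      using t(3) by (simp add: case_prod_beta)
  qed
  finally show ?thesis .
qed

lemma alternating_cnt:
  assumes "finite D" "0 < k"
  shows "(\<Sum>j\<le>k. (-1) ^ j * cnt (u @ (True, j) # (False, k - j) # w) D) = 0"
  using assms(1)
proof (induction u arbitrary: D)
  case Nil
  then show ?case using alternating_cnt_head[OF _ assms(2)] by simp
next
  case (Cons l u)
  have "(\<Sum>j\<le>k. (-1) ^ j * cnt ((l # u) @ (True, j) # (False, k - j) # w) D) =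
    (\<Sum>j\<le>k. \<Sum>A\<in>strips (fst l) (snd l) D.
      (-1) ^ j * cnt (u @ (True, j) # (False, k - j) # w) (D - A))"
    by (simp only: append_Cons cnt.simps sum_distrib_left)
  also have "\<dots> = (\<Sum>A\<in>strips (fst l) (snd l) D.
      \<Sum>j\<le>k. (-1) ^ j * cnt (u @ (True, j) # (False, k - j) # w) (D - A))"
    by (rule sum.swap)
  also have "\<dots> = 0" using Cons by (simp del: cnt.simps)
  finally show ?case .
qed

section \<open>Extending linear relations to words with primed letters\<close>

lemma cnt_relation_all_words:
  assumes fin: "finite D" "finite E" "finite F"
    and h: "\<And>ms. cnt (map (Pair True) ms) D - cnt (map (Pair True) ms) E = cnt (map (Pair True) ms) F"
  shows "cnt w D - cnt w E = cnt w F"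
proof (induction "length (filter (\<lambda>l. \<not> fst l) w)" arbitrary: w)
  case 0
  then have "\<forall>l\<in>set w. fst l" by (simp add: filter_empty_conv)
  then have "w = map (Pair True) (map snd w)" by (induction w) auto
  then show ?case using h by metis
next
  case (Suc n)
  \<comment> \<open>Inside the induction on the number of primed letters, one of them is reduced by
    induction on its multiplicity. It is replaced by an ordinary letter j \<ge> 1 followed by a
    primed letter of multiplicity k - j; the ordinary letter joins the prefix, which is why u
    varies.\<close>
  have main: "cnt (u @ (False, k) # v) D - cnt (u @ (False, k) # v) E = cnt (u @ (False, k) # v) F"
    if "length (filter (\<lambda>l. \<not> fst l) (u @ v)) = n" for u v k
    using that
  proof (induction k arbitrary: u rule: less_induct)
    case (less k)
    show ?case
    proof (cases "k = 0")
      case True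
      then show ?thesis using cnt_0 fin Suc(1)[of "u @ v"] less.prems by simp
    next
      case False
      \<comment> \<open>The alternating sum solved for its term j = 0.\<close>
      have e: "cnt (u @ (False, k) # v) X =
          - (\<Sum>j\<in>{1..k}. (-1) ^ j * cnt (u @ (True, j) # (False, k - j) # v) X)" if "finite X" for X
      proof -
        have s: "{..k} = insert 0 {1..k}" by auto
        have "(\<Sum>j\<in>insert 0 {1..k}. (-1) ^ j * cnt (u @ (True, j) # (False, k - j) # v) X) = 0"
          unfolding s[symmetric] using alternating_cnt[OF that, of k u v] False by simp
        then show ?thesis using cnt_0[OF that, of u True] by simp
      qed
      have "(-1) ^ j * cnt (u @ (True, j) # (False, k - j) # v) D
          - (-1) ^ j * cnt (u @ (True, j) # (False, k - j) # v) E
          = (-1) ^ j * cnt (u @ (True, j) # (False, k - j) # v) F" if "j \<in> {1..k}" for j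
        using less.IH[of "k - j" "u @ [(True, j)]"] less.prems that False
        by (simp del: cnt.simps flip: right_diff_distrib)
      then have "(\<Sum>j\<in>{1..k}. (-1) ^ j * cnt (u @ (True, j) # (False, k - j) # v) D)
          - (\<Sum>j\<in>{1..k}. (-1) ^ j * cnt (u @ (True, j) # (False, k - j) # v) E)
          = (\<Sum>j\<in>{1..k}. (-1) ^ j * cnt (u @ (True, j) # (False, k - j) # v) F)"
        by (simp only: sum_subtractf[symmetric] cong: sum.cong)
      then show ?thesis using fin by (simp only: e)
    qed
  qed
  from Suc(2) have "filter (\<lambda>l. \<not> fst l) w \<noteq> []" by auto
  then obtain l where "l \<in> set w" "\<not> fst l" by (metis (mono_tags) filter_empty_conv)
  then obtain u v where w: "w = u @ l # v" by (meson split_list)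
  show ?case using main[of u v "snd l"] Suc(2) \<open>\<not> fst l\<close> unfolding w
    by (cases l) auto
qed

section \<open>Tableau series as word counts\<close>

text \<open>The offset k lets the rest of a tableau keep its entries when the letter k + 1 has been
  split off, so nothing is renumbered.\<close>

definition shifted_content :: "nat \<Rightarrow> nat list \<Rightarrow> nat \<Rightarrow> nat" where
  "shifted_content k ms m = (if k < m \<and> m \<le> k + length ms then ms ! (m - Suc k) else 0)"

definition shifted_ssyt :: "nat \<Rightarrow> nat list \<Rightarrow> cell set \<Rightarrow> (cell \<Rightarrow> nat) set" where
  "shifted_ssyt k ms D = {T \<in> ssyt D. tableau_content D T = shifted_content k ms}"

lemma ssyt_iff:
  "T \<in> ssyt D \<longleftrightarrow> T \<in> D \<rightarrow>\<^sub>E {1..} \<and>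
     (\<forall>c\<in>D. \<forall>d\<in>D. before c d \<longrightarrow> T c \<le> T d \<and> (snd c = snd d \<longrightarrow> T c < T d))"
proof -
  have "(\<forall>c\<in>D. \<forall>d\<in>D. before c d \<longrightarrow> T c \<le> T d \<and> (snd c = snd d \<longrightarrow> T c < T d)) \<longleftrightarrow>
     (\<forall>i j j'. (i, j) \<in> D \<and> (i, j') \<in> D \<and> j < j' \<longrightarrow> T (i, j) \<le> T (i, j')) \<and>
     (\<forall>i i' j. (i, j) \<in> D \<and> (i', j) \<in> D \<and> i < i' \<longrightarrow> T (i, j) < T (i', j))"
    unfolding before_def by (fastforce intro: less_imp_le)
  then show ?thesis by (simp add: ssyt_def)
qed

lemma content_shifted_range:
  assumes "finite D" "tableau_content D T = shifted_content k ms" "c \<in> D"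
  shows "k < T c" "T c \<le> k + length ms"
proof -
  have "c \<in> {d \<in> D. T d = T c}" using assms(3) by simp
  moreover have "finite {d \<in> D. T d = T c}" using assms(1) by simp
  ultimately have "card {d \<in> D. T d = T c} \<noteq> 0" unfolding card_eq_0_iff by blast
  then have "tableau_content D T (T c) \<noteq> 0" unfolding tableau_content_def .
  then show "k < T c" "T c \<le> k + length ms"
    by (auto simp: assms(2) shifted_content_def split: if_splits)
qed

lemma shifted_content_Cons:
  "shifted_content k (m # ms) = (\<lambda>n. if n = Suc k then m else shifted_content (Suc k) ms n)"
proof
  fix n
  show "shifted_content k (m # ms) n = (if n = Suc k then m else shifted_content (Suc k) ms n)"
  proof (cases "Suc k < n")
    case True
    then have "n - Suc k = Suc (n - Suc (Suc k))" by simp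
    then show ?thesis using True by (auto simp: shifted_content_def)
  qed (auto simp: shifted_content_def)
qed

text \<open>The cells with the smallest entry k + 1 form an initial horizontal strip, and the
  restriction to the other cells is again a tableau, with entries above k + 1. Conversely any such
  strip and tableau fit together.\<close>

lemma card_shifted_ssyt:
  assumes "finite D"
  shows "int (card (shifted_ssyt k ms D)) = cnt (map (Pair True) ms) D"
  using assms
proof (induction ms arbitrary: k D)
  case Nil
  \<comment> \<open>By extensionality the empty diagram has exactly one tableau, the function that
    is undefined everywhere.\<close>
  have "shifted_ssyt k [] D = (if D = {} then {\<lambda>x. undefined} else {})"
  proof (cases "D = {}")
    case True
    then show ?thesis
      by (auto simp: shifted_ssyt_def ssyt_def tableau_content_def shifted_content_def fun_eq_iff)
  next
    case False
    then show ?thesis using content_shifted_range[OF Nil, of _ k "[]"]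
      by (force simp: shifted_ssyt_def)
  qed
  then show ?case by simp
next
  case (Cons m ms)
  note fin = \<open>finite D\<close>
  let ?k = "Suc k"
  let ?S = "SIGMA A:strips True m D. shifted_ssyt ?k ms (D - A)"
  define f where "f T = ({c \<in> D. T c = ?k}, restrict T {c \<in> D. T c \<noteq> ?k})" for T :: "cell \<Rightarrow> nat"
  define g where "g = (\<lambda>(A, T') (c :: cell). if c \<in> A then ?k else (T' c :: nat))"
  have "bij_betw f (shifted_ssyt k (m # ms) D) ?S"
  proof (rule bij_betw_byWitness[where f' = g])
    show "\<forall>T\<in>shifted_ssyt k (m # ms) D. g (f T) = T"
      by (auto simp: f_def g_def shifted_ssyt_def ssyt_def fun_eq_iff PiE_def extensional_def)
    show "\<forall>p\<in>?S. f (g p) = p"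
    proof clarify
      fix A T' assume A: "A \<in> strips True m D" and T': "T' \<in> shifted_ssyt ?k ms (D - A)"
      have AD: "A \<subseteq> D" using A by (rule strips_subset)
      have r: "T' c > ?k" if "c \<in> D - A" for c
        using content_shifted_range(1)[of "D - A" T' ?k ms c] T' that fin by (auto simp: shifted_ssyt_def)
      have 1: "{c \<in> D. g (A, T') c = ?k} = A" using AD r by (force simp: g_def)
      have 2: "{c \<in> D. g (A, T') c \<noteq> ?k} = D - A" using 1 by blast
      have "restrict (g (A, T')) (D - A) = T'"
        using T' by (auto simp: shifted_ssyt_def ssyt_def g_def fun_eq_iff PiE_def extensional_def restrict_def)
      then show "f (g (A, T')) = (A, T')" unfolding f_def 1 2 by simp
    qed
    show "f ` shifted_ssyt k (m # ms) D \<subseteq> ?S"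
    proof (rule image_subsetI)
      fix T assume T: "T \<in> shifted_ssyt k (m # ms) D"
      obtain A T' where fT: "f T = (A, T')" by force
      then have A: "A = {c \<in> D. T c = ?k}" and T': "T' = restrict T (D - A)"
        by (auto simp: f_def intro!: arg_cong[where f = "restrict T"])
      have T1: "T \<in> D \<rightarrow>\<^sub>E {1..}"
        and T2: "\<And>c d. c \<in> D \<Longrightarrow> d \<in> D \<Longrightarrow> before c d \<Longrightarrow> T c \<le> T d \<and> (snd c = snd d \<longrightarrow> T c < T d)"
        and T3: "tableau_content D T = shifted_content k (m # ms)"
        using T unfolding shifted_ssyt_def by (auto simp: ssyt_iff)
      have r: "?k \<le> T c" if "c \<in> D" for c
        using content_shifted_range(1)[OF fin T3 that] by simp
      have "card A = m"
        using fun_cong[OF T3, of ?k] by (simp add: tableau_content_def A shifted_content_def)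
      moreover have "initial D A"
        unfolding initial_def A using T2 r by (fastforce dest: le_antisym)
      moreover have "inj_on snd A"
      proof (rule inj_onI, rule ccontr)
        fix c d assume cd: "c \<in> A" "d \<in> A" "snd c = snd d" "c \<noteq> d"
        then have "before c d \<or> before d c" by (cases c; cases d) (auto simp: before_def)
        then show False using T2[of c d] T2[of d c] cd by (auto simp: A)
      qed
      ultimately have AS: "A \<in> strips True m D" by (simp add: strips_def strip_def)
      have "tableau_content (D - A) T' n = shifted_content ?k ms n" for n
      proof (cases "n = ?k")
        case True
        have "{c \<in> D - A. T' c = ?k} = {}" by (auto simp: T' A)
        then have "tableau_content (D - A) T' ?k = 0" unfolding tableau_content_def by (metis card.empty)
        then show ?thesis using True by (simp add: shifted_content_def)
      next
        case False
        then have "{c \<in> D - A. T' c = n} = {c \<in> D. T c = n}" by (auto simp: T' A)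
        then show ?thesis using fun_cong[OF T3, of n] False
          by (simp add: tableau_content_def shifted_content_Cons)
      qed
      moreover have "T' \<in> ssyt (D - A)"
        using T1 T2 by (auto simp: ssyt_iff T' PiE_iff)
      ultimately show "f T \<in> ?S"
        unfolding fT using AS by (auto simp: shifted_ssyt_def)
    qed
    show "g ` ?S \<subseteq> shifted_ssyt k (m # ms) D"
    proof (rule image_subsetI)
      fix p assume "p \<in> ?S"
      then obtain A T' where p: "p = (A, T')"
        and A: "A \<in> strips True m D" and T': "T' \<in> shifted_ssyt ?k ms (D - A)" by auto
      let ?T = "g (A, T')"
      have AD: "A \<subseteq> D" using A by (rule strips_subset)
      have r: "T' c > ?k" if "c \<in> D - A" for c
        using content_shifted_range(1)[of "D - A" T' ?k ms c] T' that fin by (auto simp: shifted_ssyt_def)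
      have A2: "card A = m" "inj_on snd A"
        and ini: "\<And>c d. c \<in> A \<Longrightarrow> d \<in> D \<Longrightarrow> before d c \<Longrightarrow> d \<in> A"
        using A by (auto simp: strips_def initial_def strip_def)
      have T1: "T' \<in> (D - A) \<rightarrow>\<^sub>E {1..}"
        and T2: "\<And>c d. c \<in> D - A \<Longrightarrow> d \<in> D - A \<Longrightarrow> before c d \<Longrightarrow> T' c \<le> T' d \<and> (snd c = snd d \<longrightarrow> T' c < T' d)"
        and T3: "tableau_content (D - A) T' = shifted_content ?k ms"
        using T' unfolding shifted_ssyt_def by (auto simp: ssyt_iff)
      have "?T \<in> D \<rightarrow>\<^sub>E {1..}" using T1 AD by (auto simp: g_def PiE_iff extensional_def)
      moreover have "?T c \<le> ?T d \<and> (snd c = snd d \<longrightarrow> ?T c < ?T d)"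
        if cd: "c \<in> D" "d \<in> D" "before c d" for c d
      proof (cases "d \<in> A")
        case True
        then have "c \<in> A" using ini cd by auto
        moreover have "snd c \<noteq> snd d"
          using A2(2) True \<open>c \<in> A\<close> cd(3) by (auto simp: inj_on_def before_def)
        ultimately show ?thesis using True by (simp add: g_def)
      next
        case False
        then show ?thesis using T2[of c d] r[of d] cd by (auto simp: g_def)
      qed
      moreover have "tableau_content D ?T n = shifted_content k (m # ms) n" for n
      proof (cases "n = ?k")
        case True
        have "{c \<in> D. ?T c = ?k} = A" using AD r by (force simp: g_def)
        then show ?thesis using True A2 by (simp add: tableau_content_def shifted_content_def)
      next
        case False
        then have "{c \<in> D. ?T c = n} = {c \<in> D - A. T' c = n}" by (auto simp: g_def)
        then show ?thesis using fun_cong[OF T3, of n] False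
          by (simp add: tableau_content_def shifted_content_Cons)
      qed
      ultimately show "g p \<in> shifted_ssyt k (m # ms) D"
        unfolding p by (auto simp: shifted_ssyt_def ssyt_iff)
    qed
  qed
  then have "card (shifted_ssyt k (m # ms) D) = card ?S" by (rule bij_betw_same_card)
  also have "\<dots> = (\<Sum>A\<in>strips True m D. card (shifted_ssyt ?k ms (D - A)))"
  proof (rule card_SigmaI)
    show "finite (strips True m D)" using fin by (rule finite_strips)
    show "\<forall>A\<in>strips True m D. finite (shifted_ssyt ?k ms (D - A))"
      unfolding shifted_ssyt_def using finite_tableaux_with_content fin by simp
  qed
  finally show ?case using Cons by simp
qed

lemma tableau_series_cnt:
  assumes "finite D"
  shows "tableau_series D (shifted_content 0 ms) = cnt (map (Pair True) ms) D"
  using card_shifted_ssyt[OF assms, of 0 ms] by (simp add: tableau_series_def shifted_ssyt_def)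

lemma cnt_relation:
  assumes "finite D" "finite E" "finite F"
    "tableau_series D - tableau_series E = tableau_series F"
  shows "cnt w D - cnt w E = cnt w F"
proof (rule cnt_relation_all_words[OF assms(1-3)])
  fix ms
  show "cnt (map (Pair True) ms) D - cnt (map (Pair True) ms) E = cnt (map (Pair True) ms) F"
    using fun_cong[OF assms(4), of "shifted_content 0 ms"] assms(1-3)
    by (simp add: tableau_series_cnt)
qed

section \<open>Diagrams with contiguous rows\<close>

text \<open>A row with \<open>u i \<le> t i\<close> is empty, so starts may run past the ends while
  cells are being removed.\<close>

definition shape :: "nat \<Rightarrow> (nat \<Rightarrow> nat) \<Rightarrow> (nat \<Rightarrow> nat) \<Rightarrow> cell set" where
  "shape R t u = {(i, j). i < R \<and> t i \<le> j \<and> j < u i}"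

definition rows :: "nat \<Rightarrow> (nat \<Rightarrow> nat) \<Rightarrow> (nat \<Rightarrow> nat) \<Rightarrow> nat set" where
  "rows R t u = {i. i < R \<and> t i < u i}"

definition advance :: "nat set \<Rightarrow> (nat \<Rightarrow> nat) \<Rightarrow> nat \<Rightarrow> nat" where
  "advance I t i = (if i \<in> I then Suc (t i) else t i)"

lemma finite_shape: "finite (shape R t u)"
proof -
  have "shape R t u = Sigma {..<R} (\<lambda>i. {t i..<u i})" by (auto simp: shape_def)
  then show ?thesis by simp
qed

lemma finite_rows: "finite (rows R t u)"
  by (simp add: rows_def)

lemma shape_cong:
  assumes "\<And>i. i < R \<Longrightarrow> t i < u i \<or> t' i < u i \<Longrightarrow> t i = t' i"
  shows "shape R t u = shape R t' u"
proof -
  have "i < R \<and> t i \<le> j \<and> j < u i \<longleftrightarrow> i < R \<and> t' i \<le> j \<and> j < u i" for i j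
    using assms[of i] by linarith
  then show ?thesis by (simp add: shape_def)
qed

text \<open>Having one cell per row and being closed to the left, a vertical strip consists of first
  cells and so is a set I of rows. As the starts move weakly to the left going down, a cell of the
  diagram above the first cell of row i is itself the first of its row; this is the condition on
  equal starts.\<close>

lemma strips_shape:
  assumes anti: "\<And>i i'. i' \<le> i \<Longrightarrow> i < R \<Longrightarrow> t i \<le> t i'"
  shows "strips False m (shape R t u) = (\<lambda>I. (\<lambda>i. (i, t i)) ` I) `
    {I. I \<subseteq> rows R t u \<and> card I = m \<and> (\<forall>i\<in>I. \<forall>i'<i. i' \<in> rows R t u \<and> t i' = t i \<longrightarrow> i' \<in> I)}"
    (is "?S = ?f ` ?T")
proof
  show "?S \<subseteq> ?f ` ?T"
  proof
    fix A assume "A \<in> ?S"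
    then have AD: "A \<subseteq> shape R t u" and m: "card A = m" and inj: "inj_on fst A"
      and ini: "\<And>c d. c \<in> A \<Longrightarrow> d \<in> shape R t u \<Longrightarrow> before d c \<Longrightarrow> d \<in> A"
      by (auto simp: strips_def initial_def strip_def)
    have lead: "j = t i" if "(i, j) \<in> A" for i j
    proof (rule ccontr)
      assume "j \<noteq> t i"
      then have "(i, t i) \<in> shape R t u" "before (i, t i) (i, j)"
        using AD that by (auto simp: shape_def before_def)
      then have "(i, t i) \<in> A" using ini that by blast
      then show False using inj_onD[OF inj, of "(i, t i)" "(i, j)"] that \<open>j \<noteq> t i\<close> by simp
    qed
    have A: "A = ?f (fst ` A)" using lead by (force simp: image_iff)
    moreover have "fst ` A \<in> ?T"
    proof (intro CollectI conjI ballI allI impI)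
      show "fst ` A \<subseteq> rows R t u" using AD by (force simp: shape_def rows_def)
      show "card (fst ` A) = m" using m inj by (simp add: card_image)
      fix i i' assume i: "i \<in> fst ` A" "i' < i" "i' \<in> rows R t u \<and> t i' = t i"
      then have "(i, t i) \<in> A" using lead by force
      moreover have "(i', t i) \<in> shape R t u" "before (i', t i) (i, t i)"
        using i by (auto simp: shape_def rows_def before_def)
      ultimately have "(i', t i) \<in> A" using ini by blast
      then show "i' \<in> fst ` A" by force
    qed
    ultimately show "A \<in> ?f ` ?T" by blast
  qed
  show "?f ` ?T \<subseteq> ?S"
  proof (rule image_subsetI)
    fix I assume I: "I \<in> ?T"
    have "card (?f I) = m" using I by (auto simp: card_image inj_on_def)
    moreover have "inj_on fst (?f I)" by (auto simp: inj_on_def)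
    moreover have "initial (shape R t u) (?f I)"
      unfolding initial_def
    proof (intro conjI ballI impI)
      show "?f I \<subseteq> shape R t u" using I by (auto simp: shape_def rows_def)
      fix c d assume c: "c \<in> ?f I" and d: "d \<in> shape R t u" "before d c"
      obtain i where i: "c = (i, t i)" "i \<in> I" using c by blast
      have "i < R" using i I by (auto simp: rows_def)
      obtain i' j where ij: "d = (i', j)" by force
      have "i' < i" "j = t i" using d i ij by (auto simp: before_def shape_def)
      moreover from this have "t i' = t i" using anti[of i' i] d ij \<open>i < R\<close> by (auto simp: shape_def)
      moreover have "i' \<in> rows R t u" using d ij by (auto simp: shape_def rows_def)
      ultimately have "i' \<in> I" using I i by blast
      then show "d \<in> ?f I" using \<open>t i' = t i\<close> \<open>j = t i\<close> ij by auto
    qed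
    ultimately show "?f I \<in> ?S" by (simp add: strips_def strip_def)
  qed
qed

lemma cnt_shape_vertical:
  assumes anti: "\<And>i i'. i' \<le> i \<Longrightarrow> i < R \<Longrightarrow> t i \<le> t i'"
  shows "cnt ((False, m) # w) (shape R t u) = (\<Sum>I\<in>{I. I \<subseteq> rows R t u \<and> card I = m \<and>
    (\<forall>i\<in>I. \<forall>i'<i. i' \<in> rows R t u \<and> t i' = t i \<longrightarrow> i' \<in> I)}. cnt w (shape R (advance I t) u))"
proof -
  have "shape R t u - (\<lambda>i. (i, t i)) ` I = shape R (advance I t) u" if "I \<subseteq> rows R t u" for I
    using that by (auto simp: shape_def rows_def advance_def image_iff split: if_splits)
  moreover have "inj_on (\<lambda>I. (\<lambda>i. (i, t i)) ` I) X" for X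
    by (rule inj_onI) (auto simp: set_eq_iff image_iff)
  ultimately show ?thesis
    by (simp add: strips_shape[OF anti] sum.reindex)
qed

text \<open>A strip with as many cells as there are nonempty rows must take the first cell of each,
  so the sum has a single term. Advancing the empty rows too changes nothing and gives a uniform
  formula.\<close>

lemma cnt_shape_vertical_all:
  assumes anti: "\<And>i i'. i' \<le> i \<Longrightarrow> i < R \<Longrightarrow> t i \<le> t i'"
  shows "cnt ((False, card (rows R t u)) # w) (shape R t u) = cnt w (shape R (\<lambda>i. Suc (t i)) u)"
proof -
  have "{I. I \<subseteq> rows R t u \<and> card I = card (rows R t u) \<and>
      (\<forall>i\<in>I. \<forall>i'<i. i' \<in> rows R t u \<and> t i' = t i \<longrightarrow> i' \<in> I)} = {rows R t u}"
    using card_subset_eq[OF finite_rows] by auto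
  moreover have "shape R (advance (rows R t u) t) u = shape R (\<lambda>i. Suc (t i)) u"
    by (rule shape_cong) (auto simp: advance_def rows_def split: if_splits)
  ultimately show ?thesis by (simp add: cnt_shape_vertical[OF anti] del: cnt.simps)
qed

lemma cnt_shape_vertical_zero:
  assumes anti: "\<And>i i'. i' \<le> i \<Longrightarrow> i < R \<Longrightarrow> t i \<le> t i'" and "card (rows R t u) < m"
  shows "cnt ((False, m) # w) (shape R t u) = 0"
proof -
  have "card I < m" if "I \<subseteq> rows R t u" for I
    using card_mono[OF finite_rows that] assms(2) by simp
  then have "{I. I \<subseteq> rows R t u \<and> card I = m \<and>
      (\<forall>i\<in>I. \<forall>i'<i. i' \<in> rows R t u \<and> t i' = t i \<longrightarrow> i' \<in> I)} = {}" by fast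
  then show ?thesis by (simp only: cnt_shape_vertical[OF anti] sum.empty)
qed

text \<open>If a lower row started in the same column as row r, its first cell would be taken while
  the cell of row r above it stays; hence the strict inequality on the starts.\<close>

lemma cnt_shape_vertical_all_but_one:
  assumes anti: "\<And>i i'. i' \<le> i \<Longrightarrow> i < R \<Longrightarrow> t i \<le> t i'" and ne: "\<And>i. i < R \<Longrightarrow> t i < u i" and "0 < R"
  shows "cnt ((False, R - 1) # w) (shape R t u) =
    (\<Sum>r | r < R \<and> (\<forall>i. r < i \<and> i < R \<longrightarrow> t i < t r). cnt w (shape R (\<lambda>i. if i = r then t i else Suc (t i)) u))"
proof -
  have rows: "rows R t u = {..<R}" using ne by (auto simp: rows_def)
  have "{I. I \<subseteq> rows R t u \<and> card I = R - 1 \<and>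
      (\<forall>i\<in>I. \<forall>i'<i. i' \<in> rows R t u \<and> t i' = t i \<longrightarrow> i' \<in> I)} =
    (\<lambda>r. {..<R} - {r}) ` {r. r < R \<and> (\<forall>i. r < i \<and> i < R \<longrightarrow> t i < t r)}" (is "?A = ?B")
  proof
    show "?A \<subseteq> ?B"
    proof
      fix I assume I: "I \<in> ?A"
      then have "I \<subseteq> {..<R}" "card I = R - 1" by (auto simp: rows)
      then have "card ({..<R} - I) = 1" using \<open>0 < R\<close> by (simp add: card_Diff_subset finite_subset)
      then obtain r where r: "{..<R} - I = {r}" by (rule card_1_singletonE)
      then have Ir: "I = {..<R} - {r}" using \<open>I \<subseteq> {..<R}\<close> by auto
      have "t i < t r" if "r < i" "i < R" for i
        using I anti[of r i] that r unfolding rows Ir by (force simp: le_less)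
      then show "I \<in> ?B" using Ir r by auto
    qed
    show "?B \<subseteq> ?A" using \<open>0 < R\<close> by (fastforce simp: rows)
  qed
  moreover have "inj_on (\<lambda>r. {..<R} - {r}) {r. r < R \<and> (\<forall>i. r < i \<and> i < R \<longrightarrow> t i < t r)}"
    by (rule inj_onI) auto
  moreover have "shape R (advance ({..<R} - {r}) t) u = shape R (\<lambda>i. if i = r then t i else Suc (t i)) u" for r
    by (rule shape_cong) (auto simp: advance_def)
  ultimately show ?thesis
    by (simp add: cnt_shape_vertical[OF anti] sum.reindex del: cnt.simps)
qed

text \<open>Supplies words with a positive count, to be set against counts that vanish because a
  primed letter is too long.\<close>

lemma cnt_shape_pos:
  assumes anti: "\<And>i i'. i' \<le> i \<Longrightarrow> i < R \<Longrightarrow> t i \<le> t i'"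
  obtains w where "0 < cnt w (shape R t u)"
proof -
  have "\<exists>w. 0 < cnt w (shape R t u)"
    using anti
  proof (induction "card (shape R t u)" arbitrary: t rule: less_induct)
    case less
    show ?case
    proof (cases "shape R t u = {}")
      case True
      then have "0 < cnt [] (shape R t u)" by simp
      then show ?thesis by blast
    next
      case False
      then obtain i j where "(i, j) \<in> shape R t u" by force
      then have "(i, t i) \<in> shape R t u" "(i, t i) \<notin> shape R (\<lambda>i. Suc (t i)) u"
        by (auto simp: shape_def)
      moreover have "shape R (\<lambda>i. Suc (t i)) u \<subseteq> shape R t u" by (auto simp: shape_def)
      ultimately have "card (shape R (\<lambda>i. Suc (t i)) u) < card (shape R t u)"
        by (metis finite_shape psubsetI psubset_card_mono)
      then obtain w where "0 < cnt w (shape R (\<lambda>i. Suc (t i)) u)"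
        using less(1)[of "\<lambda>i. Suc (t i)"] less(2) by auto
      then have "0 < cnt ((False, card (rows R t u)) # w) (shape R t u)"
        by (subst cnt_shape_vertical_all[OF less(2)])
      then show ?thesis by blast
    qed
  qed
  then show ?thesis using that by blast
qed

section \<open>Fillings with two ordinary letters\<close>

definition two_strips :: "cell set \<Rightarrow> cell set set" where
  "two_strips D = {A. initial D A \<and> inj_on snd A \<and> inj_on snd (D - A)}"

lemma finite_two_strips: "finite D \<Longrightarrow> finite (two_strips D)"
  by (rule finite_subset[of _ "Pow D"]) (auto simp: two_strips_def initial_def)

lemma cnt_single: "finite D \<Longrightarrow> cnt [(True, m)] D = (if card D = m \<and> inj_on snd D then 1 else 0)"
proof -
  assume "finite D"
  have "cnt [(True, m)] D = (\<Sum>A\<in>strips True m D. if A = D then 1 else 0)"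
    unfolding cnt.simps by (rule sum.cong) (auto dest: strips_subset)
  also have "\<dots> = (if D \<in> strips True m D then 1 else 0)"
    using \<open>finite D\<close> by (simp add: finite_strips)
  finally show ?thesis by (simp add: strips_def initial_def strip_def)
qed

lemma sum_cnt_single:
  assumes "finite D" "card D \<le> M"
  shows "(\<Sum>m\<le>M. cnt [(True, m)] D) = (if inj_on snd D then 1 else 0)"
  using assms by (simp add: cnt_single del: cnt.simps)

lemma sum_cnt_pair:
  assumes "finite D" "card D \<le> M"
  shows "(\<Sum>m\<le>M. cnt [(True, j), (True, m)] D) = int (card {A \<in> two_strips D. card A = j})"
proof -
  have "(\<Sum>m\<le>M. cnt [(True, j), (True, m)] D) =
      (\<Sum>A\<in>strips True j D. \<Sum>m\<le>M. cnt [(True, m)] (D - A))"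
    unfolding cnt.simps(2)[of "(True, j)"] fst_conv snd_conv by (rule sum.swap)
  also have "\<dots> = (\<Sum>A\<in>strips True j D. if inj_on snd (D - A) then 1 else 0)"
  proof (rule sum.cong)
    fix A assume "A \<in> strips True j D"
    have "card (D - A) \<le> M" using assms card_mono[of D "D - A"] by auto
    then show "(\<Sum>m\<le>M. cnt [(True, m)] (D - A)) = (if inj_on snd (D - A) then 1 else 0)"
      using assms by (intro sum_cnt_single) auto
  qed simp
  also have "\<dots> = int (card {A \<in> strips True j D. inj_on snd (D - A)})"
    using assms by (simp add: finite_strips sum.If_cases Int_def)
  also have "{A \<in> strips True j D. inj_on snd (D - A)} = {A \<in> two_strips D. card A = j}"
    by (auto simp: two_strips_def strips_def strip_def)
  finally show ?thesis .
qed

text \<open>The double sum is the series evaluated at 1 in the first two variables and at 0 in all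
  others; \<open>M\<close> only makes it finite.\<close>

lemma sum_cnt_pairs:
  assumes "finite D" "card D \<le> M"
  shows "(\<Sum>j\<le>M. \<Sum>m\<le>M. cnt [(True, j), (True, m)] D) = int (card (two_strips D))"
proof -
  have "card A \<le> M" if "A \<in> two_strips D" for A
    using that assms card_mono[of D A] by (auto simp: two_strips_def initial_def)
  then have "two_strips D = (\<Union>j\<le>M. {A \<in> two_strips D. card A = j})" by auto
  then have "card (two_strips D) = card (\<Union>j\<le>M. {A \<in> two_strips D. card A = j})" by simp
  also have "\<dots> = (\<Sum>j\<le>M. card {A \<in> two_strips D. card A = j})"
    using assms by (intro card_UN_disjoint) (auto simp: finite_two_strips)
  finally show ?thesis using assms by (simp add: sum_cnt_pair del: cnt.simps)
qed

text \<open>A set of two strips is determined by the column \<open>f i\<close> at which it cuts row \<open>i\<close>.\<close>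

lemma card_two_strips_shape:
  "card (two_strips (shape R t u)) = card {f \<in> (\<Pi>\<^sub>E i\<in>{..<R}. {t i..max (t i) (u i)}).
     \<forall>i i' j. i < i' \<and> (i, j) \<in> shape R t u \<and> (i', j) \<in> shape R t u \<longrightarrow> f i' \<le> j \<and> j < f i}"
    (is "_ = card ?F")
proof -
  let ?D = "shape R t u"
  \<comment> \<open>Of two cells in one column the upper one carries the first letter and the lower
    one the second. So a column with two cells is forced, and one with three cells cannot be
    filled.\<close>
  have two: "A \<in> two_strips ?D \<longleftrightarrow> A \<subseteq> ?D \<and>
      (\<forall>i j j'. (i, j) \<in> A \<and> (i, j') \<in> ?D \<and> j' < j \<longrightarrow> (i, j') \<in> A) \<and>
      (\<forall>i i' j. i < i' \<and> (i, j) \<in> ?D \<and> (i', j) \<in> ?D \<longrightarrow> (i', j) \<notin> A \<and> (i, j) \<in> A)" (is "?l \<longleftrightarrow> ?r") for A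
  proof
    assume l: ?l
    then have AD: "A \<subseteq> ?D" and ini: "\<And>c d. c \<in> A \<Longrightarrow> d \<in> ?D \<Longrightarrow> before d c \<Longrightarrow> d \<in> A"
      and inj: "inj_on snd A" "inj_on snd (?D - A)"
      by (auto simp: two_strips_def initial_def)
    have "(i', j) \<notin> A \<and> (i, j) \<in> A" if ij: "i < i'" "(i, j) \<in> ?D" "(i', j) \<in> ?D" for i i' j
    proof -
      have "(i', j) \<notin> A"
      proof
        assume a: "(i', j) \<in> A"
        then have "(i, j) \<in> A" using ini[OF a ij(2)] ij(1) by (simp add: before_def)
        then show False using inj_onD[OF inj(1), of "(i, j)" "(i', j)"] a ij(1) by simp
      qed
      moreover have "(i, j) \<in> A"
        using inj_onD[OF inj(2), of "(i, j)" "(i', j)"] ij calculation by auto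
      ultimately show ?thesis by blast
    qed
    then show ?r using AD ini by (auto simp: before_def)
  next
    assume r: ?r
    have "inj_on snd A" "inj_on snd (?D - A)"
      using r by (auto intro!: inj_onI) (metis linorder_neqE_nat subsetD)+
    moreover have "initial ?D A"
      using r unfolding initial_def before_def by (metis (no_types, lifting) prod.collapse subsetD)
    ultimately show ?l by (simp add: two_strips_def)
  qed
  define c where "c f = shape R t f" for f
  have cin: "(i, j) \<in> c f \<longleftrightarrow> j < f i" if "f \<in> (\<Pi>\<^sub>E i\<in>{..<R}. {t i..max (t i) (u i)})" "(i, j) \<in> ?D" for f i j
    using that by (auto simp: c_def shape_def)
  have csub: "c f \<subseteq> ?D" if f: "f \<in> (\<Pi>\<^sub>E i\<in>{..<R}. {t i..max (t i) (u i)})" for f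
  proof clarify
    fix i j assume "(i, j) \<in> c f"
    then have "i < R" "t i \<le> j" "j < f i" by (auto simp: c_def shape_def)
    moreover from this have "f i \<le> max (t i) (u i)" using PiE_mem[OF f, of i] by simp
    ultimately show "(i, j) \<in> ?D" by (auto simp: shape_def)
  qed
  have "bij_betw c ?F (two_strips ?D)"
    unfolding bij_betw_def
  proof
    show "inj_on c ?F"
    proof (rule inj_onI)
      fix f g assume f: "f \<in> ?F" and g: "g \<in> ?F" and eq: "c f = c g"
      have "f i = g i" if "i < R" for i
      proof (rule ccontr)
        assume ne: "f i \<noteq> g i"
        have b: "t i \<le> f i" "t i \<le> g i" using f g that by (auto simp: PiE_iff)
        define j where "j = min (f i) (g i)"
        have "((i, j) \<in> c f) \<noteq> ((i, j) \<in> c g)"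
          using ne b that by (auto simp: j_def c_def shape_def)
        then show False using eq by simp
      qed
      then show "f = g" using f g by (intro PiE_ext[of f "{..<R}" _ g]) auto
    qed
    show "c ` ?F = two_strips ?D"
    proof
      show "c ` ?F \<subseteq> two_strips ?D"
      proof (rule image_subsetI)
        fix f assume f: "f \<in> ?F"
        have "(i, j') \<in> c f" if "(i, j) \<in> c f" "(i, j') \<in> ?D" "j' < j" for i j j'
          using that by (auto simp: c_def shape_def)
        moreover have "(i', j) \<notin> c f \<and> (i, j) \<in> c f"
          if "i < i'" "(i, j) \<in> ?D" "(i', j) \<in> ?D" for i i' j
        proof -
          have "f i' \<le> j \<and> j < f i" using f that by blast
          then show ?thesis using f that cin[of f i j] cin[of f i' j] by auto
        qed
        moreover have "c f \<subseteq> ?D" using csub f by simp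
        ultimately show "c f \<in> two_strips ?D" unfolding two by (intro conjI allI impI; (elim conjE)?; blast)
      qed
      show "two_strips ?D \<subseteq> c ` ?F"
      proof
        fix A assume "A \<in> two_strips ?D"
        then have AD: "A \<subseteq> ?D" and ini: "\<And>i j j'. (i, j) \<in> A \<Longrightarrow> (i, j') \<in> ?D \<Longrightarrow> j' < j \<Longrightarrow> (i, j') \<in> A"
          and col: "\<And>i i' j. i < i' \<Longrightarrow> (i, j) \<in> ?D \<Longrightarrow> (i', j) \<in> ?D \<Longrightarrow> (i', j) \<notin> A \<and> (i, j) \<in> A"
          unfolding two by blast+
        define f where "f = (\<lambda>i\<in>{..<R}. LEAST j. t i \<le> j \<and> (i, j) \<notin> A)"
        have f1: "t i \<le> f i \<and> (i, f i) \<notin> A" and f2: "f i \<le> max (t i) (u i)"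
          and f3: "\<And>j. t i \<le> j \<Longrightarrow> j < f i \<Longrightarrow> (i, j) \<in> A" if "i < R" for i
        proof -
          \<comment> \<open>The end of the row, or its start if the row is empty, is never in A; it
            bounds the cut and gives an empty row exactly one cut.\<close>
          have ex: "t i \<le> max (t i) (u i) \<and> (i, max (t i) (u i)) \<notin> A"
            using AD by (auto simp: shape_def)
          show "t i \<le> f i \<and> (i, f i) \<notin> A"
            using LeastI[where P = "\<lambda>j. t i \<le> j \<and> (i, j) \<notin> A", OF ex] that by (simp add: f_def)
          show "f i \<le> max (t i) (u i)"
            using Least_le[where P = "\<lambda>j. t i \<le> j \<and> (i, j) \<notin> A", OF ex] that by (simp add: f_def)
          show "(i, j) \<in> A" if "t i \<le> j" "j < f i" for j
            using not_less_Least[where P = "\<lambda>j. t i \<le> j \<and> (i, j) \<notin> A", of j] that \<open>i < R\<close>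
            by (simp add: f_def)
        qed
        have fPi: "f \<in> (\<Pi>\<^sub>E i\<in>{..<R}. {t i..max (t i) (u i)})"
          using f1 f2 by (auto simp: f_def)
        have A: "(i, j) \<in> A \<longleftrightarrow> j < f i" if ij: "(i, j) \<in> ?D" for i j
        proof
          assume a: "(i, j) \<in> A"
          show "j < f i"
          proof (rule ccontr)
            assume "\<not> j < f i"
            moreover have "j \<noteq> f i" using f1[of i] a ij by (auto simp: shape_def)
            ultimately have "f i < j" by simp
            moreover have "(i, f i) \<in> ?D" using f1[of i] ij \<open>f i < j\<close> by (auto simp: shape_def)
            ultimately have "(i, f i) \<in> A" using ini a by blast
            then show False using f1[of i] ij by (auto simp: shape_def)
          qed
        next
          assume "j < f i"
          then show "(i, j) \<in> A" using f3[of i j] ij by (auto simp: shape_def)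
        qed
        have "A = c f"
        proof -
          have "(i, j) \<in> A \<longleftrightarrow> (i, j) \<in> c f" for i j
            using A[of i j] AD csub[OF fPi] cin[OF fPi, of i j] by blast
          then show ?thesis by (auto simp: set_eq_iff)
        qed
        moreover have "f \<in> ?F" using fPi A col by (auto simp: not_less)
        ultimately show "A \<in> c ` ?F" by blast
      qed
    qed
  qed
  then show ?thesis by (simp add: bij_betw_same_card)
qed

text \<open>Without shared columns the cuts are independent, and a row of n cells has n + 1 of
  them.\<close>

lemma card_two_strips_columns_disjoint:
  assumes "\<And>i i' j. i < i' \<Longrightarrow> (i, j) \<in> shape R t u \<Longrightarrow> (i', j) \<in> shape R t u \<Longrightarrow> False"
  shows "card (two_strips (shape R t u)) = (\<Prod>i<R. Suc (u i - t i))"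
proof -
  have "{f \<in> (\<Pi>\<^sub>E i\<in>{..<R}. {t i..max (t i) (u i)}).
     \<forall>i i' j. i < i' \<and> (i, j) \<in> shape R t u \<and> (i', j) \<in> shape R t u \<longrightarrow> f i' \<le> j \<and> j < f i} =
     (\<Pi>\<^sub>E i\<in>{..<R}. {t i..max (t i) (u i)})"
    using assms by blast
  then show ?thesis
    by (simp add: card_two_strips_shape card_PiE) (rule prod.cong, auto simp: max_def)
qed

text \<open>Without shared columns the first cell of each row is minimal, and whatever is left is a
  horizontal strip.\<close>

lemma two_strips_singleton_columns_disjoint:
  assumes "\<And>i i' j. i < i' \<Longrightarrow> (i, j) \<in> shape R t u \<Longrightarrow> (i', j) \<in> shape R t u \<Longrightarrow> False"
  shows "card {A \<in> two_strips (shape R t u). card A = 1} = card (rows R t u)"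
proof -
  let ?D = "shape R t u"
  have inj: "inj_on snd X" if "X \<subseteq> ?D" for X
  proof (rule inj_onI, rule ccontr)
    fix c d assume cd: "c \<in> X" "d \<in> X" "snd c = snd d" "c \<noteq> d"
    obtain i j i' j' where "c = (i, j)" "d = (i', j')" by (metis prod.collapse)
    then show False using cd that assms[of i i' j] assms[of i' i j] by (cases i i' rule: linorder_cases) auto
  qed
  have "{A \<in> two_strips ?D. card A = 1} = (\<lambda>i. {(i, t i)}) ` rows R t u"
  proof
    show "{A \<in> two_strips ?D. card A = 1} \<subseteq> (\<lambda>i. {(i, t i)}) ` rows R t u"
    proof
      fix A assume A: "A \<in> {A \<in> two_strips ?D. card A = 1}"
      then have "card A = 1" by simp
      then obtain c where c: "A = {c}" by (rule card_1_singletonE)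
      obtain i j where ij: "c = (i, j)" by force
      have ini: "initial ?D {(i, j)}" using A by (simp add: c ij two_strips_def)
      then have D: "(i, j) \<in> ?D" by (simp add: initial_def)
      have "j = t i"
      proof (rule ccontr)
        assume "j \<noteq> t i"
        then have "(i, t i) \<in> ?D" "before (i, t i) (i, j)" using D by (auto simp: shape_def before_def)
        then show False using ini \<open>j \<noteq> t i\<close> by (auto simp: initial_def)
      qed
      then show "A \<in> (\<lambda>i. {(i, t i)}) ` rows R t u" using D by (auto simp: c ij shape_def rows_def)
    qed
    show "(\<lambda>i. {(i, t i)}) ` rows R t u \<subseteq> {A \<in> two_strips ?D. card A = 1}"
    proof (rule image_subsetI)
      fix i assume i: "i \<in> rows R t u"
      then have D: "(i, t i) \<in> ?D" by (simp add: rows_def shape_def)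
      have "d = (i, t i)" if "d \<in> ?D" "before d (i, t i)" for d
      proof -
        obtain i' j where d: "d = (i', j)" by force
        show ?thesis using that D assms[of i' i "t i"] by (auto simp: d before_def shape_def)
      qed
      then have "initial ?D {(i, t i)}" using D by (auto simp: initial_def)
      then show "{(i, t i)} \<in> {A \<in> two_strips ?D. card A = 1}"
        using inj[of "?D - {(i, t i)}"] by (simp add: two_strips_def)
    qed
  qed
  moreover have "inj_on (\<lambda>i. {(i, t i)}) (rows R t u)" by (rule inj_onI) simp
  ultimately show ?thesis by (simp add: card_image)
qed

section \<open>Levels of ribbons and Young diagrams\<close>

text \<open>For a partition, the length of column k, that is, the conjugate partition. In general it
  is the number of rows that survive the removal of k cells from each row.\<close>

definition parts_above :: "nat list \<Rightarrow> nat \<Rightarrow> nat" where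
  "parts_above x k = length (filter (\<lambda>y. k < y) x)"

definition antitone :: "(nat \<Rightarrow> nat) \<Rightarrow> nat \<Rightarrow> bool" where
  "antitone s R \<longleftrightarrow> (\<forall>i i'. i' \<le> i \<longrightarrow> i < R \<longrightarrow> s i \<le> s i')"

text \<open>Keeping the row starts \<open>s\<close> as a parameter lets the same peeling lemmas
  serve Young diagrams, where k columns are gone, and ribbons, where the rows fall apart.\<close>

definition level :: "(nat \<Rightarrow> nat) \<Rightarrow> nat list \<Rightarrow> nat \<Rightarrow> cell set" where
  "level s x k = shape (length x) (\<lambda>i. s i + k) (\<lambda>i. s i + x ! i)"

lemma finite_level: "finite (level s x k)"
  by (simp add: level_def finite_shape)

lemma card_rows_level: "card (rows (length x) (\<lambda>i. s i + k) (\<lambda>i. s i + x ! i)) = parts_above x k"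
  by (simp add: rows_def parts_above_def length_filter_conv_card)

lemma cnt_level_peel:
  assumes "antitone s (length x)"
  shows "cnt ((False, parts_above x k) # w) (level s x k) = cnt w (level s x (Suc k))"
  using cnt_shape_vertical_all[of "length x" "\<lambda>i. s i + k" "\<lambda>i. s i + x ! i" w] assms
  by (simp add: level_def card_rows_level antitone_def del: cnt.simps)

lemma cnt_level_zero:
  assumes "antitone s (length x)" "parts_above x k < m"
  shows "cnt ((False, m) # w) (level s x k) = 0"
  using cnt_shape_vertical_zero[of "length x" "\<lambda>i. s i + k" "\<lambda>i. s i + x ! i" m w] assms
  by (simp add: level_def card_rows_level antitone_def del: cnt.simps)

lemma cnt_level_pos:
  assumes "antitone s (length x)"
  obtains w where "0 < cnt w (level s x k)"
  using cnt_shape_pos[of "length x" "\<lambda>i. s i + k" "\<lambda>i. s i + x ! i"] assms that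
  by (auto simp: level_def antitone_def)

lemma antitone_zero: "antitone (\<lambda>_. 0) R"
  by (simp add: antitone_def)

lemma antitone_ribbon_start: "antitone (ribbon_start \<alpha>) R"
  unfolding antitone_def ribbon_start_def by (intro allI impI sum_mono2) auto

lemma young_diagram_level: "young_diagram \<nu> = level (\<lambda>_. 0) \<nu> 0"
  by (auto simp: young_diagram_def level_def shape_def)

lemma ribbon_diagram_level: "ribbon_diagram \<alpha> = level (ribbon_start \<alpha>) \<alpha> 0"
  by (auto simp: ribbon_diagram_def level_def shape_def)

lemma ribbon_start_Suc:
  assumes "composition \<alpha>" "Suc i < length \<alpha>"
  shows "Suc (ribbon_start \<alpha> i) = ribbon_start \<alpha> (Suc i) + \<alpha> ! Suc i"
proof -
  have "0 < \<alpha> ! Suc i" using assms by (simp add: composition_def)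
  then show ?thesis using ribbon_rows_overlap[OF assms] by simp
qed

lemma ribbon_end_le:
  assumes "composition \<alpha>" "i < i'" "i' < length \<alpha>"
  shows "ribbon_start \<alpha> i' + \<alpha> ! i' \<le> Suc (ribbon_start \<alpha> i)"
proof -
  obtain i'' where i: "i' = Suc i''" using assms(2) by (cases i') auto
  have "ribbon_start \<alpha> i'' \<le> ribbon_start \<alpha> i"
    using antitone_ribbon_start[of \<alpha> "length \<alpha>"] assms i by (simp add: antitone_def)
  then show ?thesis using ribbon_start_Suc[OF assms(1), of i''] assms i by simp
qed

text \<open>In a ribbon a row meets the rows below it only in the column of its own first cell, and
  for k > 0 that cell has been removed.\<close>

lemma ribbon_level_columns_disjoint:
  assumes "composition \<alpha>" "0 < k" "i < i'"
    "(i, j) \<in> level (ribbon_start \<alpha>) \<alpha> k" "(i', j) \<in> level (ribbon_start \<alpha>) \<alpha> k"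
  shows False
  using assms ribbon_end_le[OF assms(1,3)] by (auto simp: level_def shape_def)

lemma prod_list_nth: "prod_list (map f x) = (\<Prod>i<length x. f (x ! i))"
  by (induction x rule: rev_induct) (auto simp: nth_append intro!: prod.cong)

lemma card_two_strips_ribbon_level:
  assumes "composition \<alpha>" "0 < k"
  shows "card (two_strips (level (ribbon_start \<alpha>) \<alpha> k)) = prod_list (map (\<lambda>x. Suc (x - k)) \<alpha>)"
  using card_two_strips_columns_disjoint[OF ribbon_level_columns_disjoint[OF assms, unfolded level_def]]
  by (simp add: level_def prod_list_nth)

lemma card_two_strips_singleton_ribbon_level:
  assumes "composition \<alpha>" "0 < k"
  shows "card {A \<in> two_strips (level (ribbon_start \<alpha>) \<alpha> k). card A = 1} = parts_above \<alpha> k"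
  using two_strips_singleton_columns_disjoint[OF ribbon_level_columns_disjoint[OF assms, unfolded level_def]]
  by (simp add: level_def card_rows_level)

section \<open>Columns of Young diagrams\<close>

lemma less_parts_above_iff:
  assumes "sorted_wrt (\<ge>) \<nu>"
  shows "i < parts_above \<nu> k \<longleftrightarrow> i < length \<nu> \<and> k < \<nu> ! i"
proof -
  let ?S = "{i. i < length \<nu> \<and> k < \<nu> ! i}"
  have c: "parts_above \<nu> k = card ?S" by (simp add: parts_above_def length_filter_conv_card)
  have down: "i' \<in> ?S" if "i \<in> ?S" "i' \<le> i" for i i'
    using sorted_wrt_nth_less[OF assms, of i' i] that by (cases "i' = i") auto
  show ?thesis
  proof
    assume i: "i < parts_above \<nu> k"
    show "i < length \<nu> \<and> k < \<nu> ! i"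
    proof (rule ccontr)
      assume "\<not> ?thesis"
      then have "?S \<subseteq> {..<i}" using down[of _ i] by (auto simp: not_less[symmetric])
      then have "card ?S \<le> i" using card_mono[of "{..<i}" ?S] by simp
      then show False using i c by simp
    qed
  next
    assume "i < length \<nu> \<and> k < \<nu> ! i"
    then have "{..i} \<subseteq> ?S" using down[of i] by auto
    then have "Suc i \<le> card ?S" using card_mono[of ?S "{..i}"] by simp
    then show "i < parts_above \<nu> k" using c by simp
  qed
qed

lemma young_level_iff: "(i, j) \<in> level (\<lambda>_. 0) \<nu> k \<longleftrightarrow> i < length \<nu> \<and> k \<le> j \<and> j < \<nu> ! i"
  by (simp add: level_def shape_def)

text \<open>Pigeonhole: three cells of one column would carry distinct letters out of two.\<close>

lemma two_strips_young_level_empty: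
  assumes "sorted_wrt (\<ge>) \<nu>" "2 < parts_above \<nu> k"
  shows "two_strips (level (\<lambda>_. 0) \<nu> k) = {}"
proof (rule equals0I)
  fix A assume A: "A \<in> two_strips (level (\<lambda>_. 0) \<nu> k)"
  have D: "(i, k) \<in> level (\<lambda>_. 0) \<nu> k" if "i \<le> 2" for i
    using less_parts_above_iff[OF assms(1), of i k] assms(2) that by (simp add: young_level_iff)
  have inj: "inj_on snd A" "inj_on snd (level (\<lambda>_. 0) \<nu> k - A)"
    using A by (auto simp: two_strips_def)
  show False
    using inj_onD[OF inj(1), of "(0, k)" "(1, k)"] inj_onD[OF inj(1), of "(0, k)" "(2, k)"]
      inj_onD[OF inj(1), of "(1, k)" "(2, k)"]
      inj_onD[OF inj(2), of "(0, k)" "(1, k)"] inj_onD[OF inj(2), of "(0, k)" "(2, k)"]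
      inj_onD[OF inj(2), of "(1, k)" "(2, k)"] D[of 0] D[of 1] D[of 2]
    by auto
qed

text \<open>The only minimal cell is the upper left one, so the strip is that cell. What remains
  must be a horizontal strip, which bounds the two leading columns.\<close>

lemma two_strips_singleton_young_level:
  fixes k
  assumes "sorted_wrt (\<ge>) \<nu>"
  defines "X \<equiv> {A \<in> two_strips (level (\<lambda>_. 0) \<nu> k). card A = 1}"
  shows "card X \<le> 1" "X \<noteq> {} \<Longrightarrow> parts_above \<nu> k \<le> 2 \<and> parts_above \<nu> (Suc k) \<le> 1"
proof -
  let ?D = "level (\<lambda>_. 0) \<nu> k"
  have A0: "A = {(0, k)}" if "A \<in> X" for A
  proof -
    have "card A = 1" using that by (simp add: X_def)
    then obtain c where c: "A = {c}" by (rule card_1_singletonE)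
    obtain i j where ij: "c = (i, j)" by force
    have ini: "initial ?D {(i, j)}" using that by (simp add: c ij two_strips_def X_def)
    then have D: "(i, j) \<in> ?D" by (simp add: initial_def)
    then have "i < length \<nu>" "k \<le> j" "j < \<nu> ! i" by (auto simp: young_level_iff)
    then have D2: "(i, k) \<in> ?D" by (simp add: young_level_iff)
    have "j = k"
    proof (rule ccontr)
      assume "j \<noteq> k"
      then have "before (i, k) (i, j)" using \<open>k \<le> j\<close> by (auto simp: before_def)
      then show False using ini \<open>j \<noteq> k\<close> D2 by (auto simp: initial_def)
    qed
    moreover have "i = 0"
    proof (rule ccontr)
      assume "i \<noteq> 0"
      then have "\<nu> ! i \<le> \<nu> ! 0" using sorted_wrt_nth_less[OF assms(1), of 0 i] \<open>i < length \<nu>\<close> by simp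
      then have "(0, j) \<in> ?D" using D by (auto simp: young_level_iff)
      moreover have "before (0, j) (i, j)" using \<open>i \<noteq> 0\<close> by (auto simp: before_def)
      ultimately show False using ini \<open>i \<noteq> 0\<close> by (auto simp: initial_def)
    qed
    ultimately show ?thesis using c ij by simp
  qed
  then have "X \<subseteq> {{(0, k)}}" by blast
  then show "card X \<le> 1" using card_mono[of "{{(0, k)}}" X] by simp
  assume "X \<noteq> {}"
  then have "{(0, k)} \<in> X" using A0 by blast
  then have two: "{(0, k)} \<in> two_strips ?D" by (simp add: X_def)
  then have inj: "inj_on snd (?D - {(0, k)})" by (simp add: two_strips_def)
  have "parts_above \<nu> k \<le> 2" using two_strips_young_level_empty[OF assms(1), of k] two by fastforce
  moreover have "parts_above \<nu> (Suc k) \<le> 1"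
  proof (rule ccontr)
    assume "\<not> ?thesis"
    then have "1 < parts_above \<nu> (Suc k)" "0 < parts_above \<nu> (Suc k)" by auto
    then have "(0, Suc k) \<in> ?D" "(1, Suc k) \<in> ?D"
      unfolding less_parts_above_iff[OF assms(1)] by (auto simp: young_level_iff)
    then show False using inj_onD[OF inj, of "(0, Suc k)" "(1, Suc k)"] by simp
  qed
  ultimately show "parts_above \<nu> k \<le> 2 \<and> parts_above \<nu> (Suc k) \<le> 1" by simp
qed

section \<open>The parts of the two compositions\<close>

abbreviation ribbon_level :: "nat list \<Rightarrow> nat \<Rightarrow> cell set" where
  "ribbon_level \<alpha> \<equiv> level (ribbon_start \<alpha>) \<alpha>"

abbreviation young_level :: "nat list \<Rightarrow> nat \<Rightarrow> cell set" where
  "young_level \<nu> \<equiv> level (\<lambda>_. 0) \<nu>"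

lemma parts_above_Nil [simp]: "parts_above [] k = 0"
  and parts_above_Cons [simp]: "parts_above (y # ys) k = (if k < y then 1 else 0) + parts_above ys k"
  by (simp_all add: parts_above_def)

lemma parts_above_0: "composition x \<Longrightarrow> parts_above x 0 = length x"
  by (induction x) (auto simp: composition_def)

lemma parts_above_eq_0_iff: "parts_above x k = 0 \<longleftrightarrow> (\<forall>y\<in>set x. y \<le> k)"
  by (auto simp: parts_above_def filter_empty_conv)

lemma sum_list_diff_Suc: "(\<Sum>y\<leftarrow>x. y - k) = parts_above x k + (\<Sum>y\<leftarrow>x. y - Suc k)"
  by (induction x) auto

text \<open>A single part above m carries the whole excess over m, so the sum of the excesses
  determines it.\<close>

lemma parts_above_le_1:
  assumes "parts_above x m \<le> 1" "m \<le> j"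
  shows "parts_above x j = (if j < m + (\<Sum>y\<leftarrow>x. y - m) then 1 else 0)"
  using assms
proof (induction x)
  case (Cons y ys)
  show ?case
  proof (cases "m < y")
    case True
    then have "parts_above ys m = 0" using Cons.prems by simp
    then have "\<forall>z\<in>set ys. z \<le> m" by (simp add: parts_above_eq_0_iff)
    then have z: "parts_above ys j = 0" "(\<Sum>y\<leftarrow>ys. y - m) = 0"
      using \<open>m \<le> j\<close> by (auto simp: parts_above_eq_0_iff)
    show ?thesis
      unfolding parts_above_Cons list.map sum_list.Cons z using True by auto
  next
    case False
    then show ?thesis using Cons by auto
  qed
qed simp

lemma count_parts_above: "count (mset x) (Suc v) + parts_above x (Suc v) = parts_above x v"
  by (induction x) auto

lemma mset_eq_parts_above:
  assumes "composition x" "composition y" "\<And>k. parts_above x k = parts_above y k"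
  shows "mset x = mset y"
proof (rule multiset_eqI)
  fix v
  show "count (mset x) v = count (mset y) v"
  proof (cases v)
    case 0
    have "0 \<notin># mset x" "0 \<notin># mset y" using assms(1,2) by (auto simp: composition_def)
    then show ?thesis by (simp only: 0 not_in_iff)
  next
    case (Suc v')
    then show ?thesis
      using count_parts_above[of x v'] count_parts_above[of y v'] assms(3) by simp
  qed
qed

text \<open>\<open>parts_above x k\<close> is the largest multiplicity of a primed letter that does
  not annihilate level k, so the counts determine it. Peeling this letter carries the equality of
  counts to the next level.\<close>

lemma level_eq_parts_above:
  assumes "antitone s (length x)" "antitone t (length y)"
    "\<And>w. cnt w (level s x k) = cnt w (level t y k)" "k \<le> j"
  shows "parts_above x j = parts_above y j"
proof -
  have *: "parts_above x k = parts_above y k" if "\<And>w. cnt w (level s x k) = cnt w (level t y k)" for k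
  proof (rule ccontr)
    assume "parts_above x k \<noteq> parts_above y k"
    then consider "parts_above x k < parts_above y k" | "parts_above y k < parts_above x k" by linarith
    then show False
    proof cases
      case 1
      obtain w where "0 < cnt w (level t y (Suc k))" using cnt_level_pos[OF assms(2)] .
      then show False
        using that[of "(False, parts_above y k) # w"] 1 assms(1,2)
        by (simp add: cnt_level_peel cnt_level_zero del: cnt.simps)
    next
      case 2
      obtain w where "0 < cnt w (level s x (Suc k))" using cnt_level_pos[OF assms(1)] .
      then show False
        using that[of "(False, parts_above x k) # w"] 2 assms(1,2)
        by (simp add: cnt_level_peel cnt_level_zero del: cnt.simps)
    qed
  qed
  have "cnt w (level s x j) = cnt w (level t y j)" for w
    using \<open>k \<le> j\<close>
  proof (induction j arbitrary: w rule: dec_induct)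
    case base
    show ?case by (rule assms(3))
  next
    case (step j)
    have "cnt ((False, parts_above x j) # w) (level s x j) = cnt ((False, parts_above y j) # w) (level t y j)"
      using step.IH *[OF step.IH] by (simp del: cnt.simps)
    then show ?case using assms(1,2) by (simp add: cnt_level_peel del: cnt.simps)
  qed
  then show ?thesis by (rule *)
qed

definition level_relation :: "nat list \<Rightarrow> nat list \<Rightarrow> nat list \<Rightarrow> nat \<Rightarrow> bool" where
  "level_relation \<alpha> \<beta> \<nu> k \<longleftrightarrow>
     (\<forall>w. cnt w (ribbon_level \<alpha> k) - cnt w (ribbon_level \<beta> k) = cnt w (young_level \<nu> k))"

lemma level_relation_pairs:
  assumes "level_relation \<alpha> \<beta> \<nu> k"
  shows "int (card (two_strips (ribbon_level \<alpha> k))) - int (card (two_strips (ribbon_level \<beta> k))) =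
      int (card (two_strips (young_level \<nu> k)))"
    and "int (card {A \<in> two_strips (ribbon_level \<alpha> k). card A = j})
      - int (card {A \<in> two_strips (ribbon_level \<beta> k). card A = j})
      = int (card {A \<in> two_strips (young_level \<nu> k). card A = j})"
proof -
  \<comment> \<open>A common bound for the three diagrams, so that all of them are summed over the
    same words.\<close>
  define M where "M = card (ribbon_level \<alpha> k) + card (ribbon_level \<beta> k) + card (young_level \<nu> k)"
  have M: "card (ribbon_level \<alpha> k) \<le> M" "card (ribbon_level \<beta> k) \<le> M" "card (young_level \<nu> k) \<le> M"
    by (auto simp: M_def)
  have rel: "cnt w (young_level \<nu> k) = cnt w (ribbon_level \<alpha> k) - cnt w (ribbon_level \<beta> k)" for w
    using assms by (simp add: level_relation_def)
  show "int (card (two_strips (ribbon_level \<alpha> k))) - int (card (two_strips (ribbon_level \<beta> k))) =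
      int (card (two_strips (young_level \<nu> k)))"
    using M by (simp add: sum_cnt_pairs[OF finite_level, symmetric] rel sum_subtractf del: cnt.simps)
  show "int (card {A \<in> two_strips (ribbon_level \<alpha> k). card A = j})
      - int (card {A \<in> two_strips (ribbon_level \<beta> k). card A = j})
      = int (card {A \<in> two_strips (young_level \<nu> k). card A = j})"
    using M by (simp add: sum_cnt_pair[OF finite_level, symmetric] rel sum_subtractf del: cnt.simps)
qed

text \<open>If \<nu> had more rows than the ribbons, a letter of its length would annihilate both
  ribbons but not \<nu>. If it had fewer, the letter of their length would annihilate only \<nu>;
  the ribbons would then agree in all counts from the next level on, against their difference at
  level k'.\<close>

lemma level_relation_Suc:
  assumes rel: "level_relation \<alpha> \<beta> \<nu> k" and eq: "parts_above \<alpha> k = parts_above \<beta> k"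
    and "k < k'" "parts_above \<alpha> k' \<noteq> parts_above \<beta> k'"
  shows "parts_above \<nu> k = parts_above \<alpha> k" "level_relation \<alpha> \<beta> \<nu> (Suc k)"
proof -
  note peel = cnt_level_peel[OF antitone_ribbon_start] cnt_level_peel[OF antitone_zero]
    cnt_level_zero[OF antitone_ribbon_start] cnt_level_zero[OF antitone_zero]
  have rel: "cnt w (ribbon_level \<alpha> k) - cnt w (ribbon_level \<beta> k) = cnt w (young_level \<nu> k)" for w
    using rel by (simp add: level_relation_def)
  note eq' = eq[symmetric]
  have "\<not> parts_above \<alpha> k < parts_above \<nu> k"
  proof
    assume "parts_above \<alpha> k < parts_above \<nu> k"
    moreover obtain w where "0 < cnt w (young_level \<nu> (Suc k))" using cnt_level_pos[OF antitone_zero] .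
    ultimately show False
      using rel[of "(False, parts_above \<nu> k) # w"] eq by (simp add: peel del: cnt.simps)
  qed
  moreover have "\<not> parts_above \<nu> k < parts_above \<alpha> k"
  proof
    assume less: "parts_above \<nu> k < parts_above \<alpha> k"
    have "cnt w (ribbon_level \<alpha> (Suc k)) = cnt w (ribbon_level \<beta> (Suc k))" for w
      using rel[of "(False, parts_above \<alpha> k) # w"] peel(4)[OF less, of w] peel(1)[of \<alpha> k w]
        peel(1)[of \<beta> k w, folded eq]
      by (simp del: cnt.simps)
    then have "parts_above \<alpha> k' = parts_above \<beta> k'"
      using \<open>k < k'\<close> by (intro level_eq_parts_above[OF antitone_ribbon_start antitone_ribbon_start]) auto
    then show False using assms(4) by simp
  qed
  ultimately show l: "parts_above \<nu> k = parts_above \<alpha> k" by simp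
  have "cnt w (ribbon_level \<alpha> (Suc k)) - cnt w (ribbon_level \<beta> (Suc k)) = cnt w (young_level \<nu> (Suc k))" for w
    using rel[of "(False, parts_above \<alpha> k) # w"] peel(1)[of \<alpha> k w]
      peel(1)[of \<beta> k w, folded eq] peel(2)[of \<nu> k w, unfolded l]
    by (simp del: cnt.simps)
  then show "level_relation \<alpha> \<beta> \<nu> (Suc k)" by (simp add: level_relation_def)
qed

text \<open>All is decided at the first level k where the numbers p and q of nonempty rows of
  \<alpha> and \<beta> differ. Of the fillings by two letters that use the first letter once, a
  ribbon has one per row and \<nu> at most one. So p - q = 1, and such a filling of \<nu> exists,
  which leaves \<nu> at most two rows there, the second with at most one cell.\<close>

lemma parts_of_ribbons:
  assumes comp: "composition \<alpha>" "composition \<beta>" "int_partition \<nu>"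
    and len: "length \<alpha> = length \<beta>"
    and sums: "sum_list \<alpha> = sum_list \<nu>" "sum_list \<beta> = sum_list \<nu>"
    and rel0: "level_relation \<alpha> \<beta> \<nu> 0" and ne: "mset \<alpha> \<noteq> mset \<beta>"
  obtains a b d where "2 \<le> b" "b \<le> a" "\<nu> = [a, b] @ replicate d 1"
    "mset \<alpha> = mset ([a, b] @ replicate d 1)" "mset \<beta> = mset ([a + 1, b - 1] @ replicate d 1)"
proof -
  have \<nu>: "composition \<nu>" "sorted_wrt (\<ge>) \<nu>" using comp(3) by (auto simp: int_partition_def)
  define k where "k = (LEAST k. parts_above \<alpha> k \<noteq> parts_above \<beta> k)"
  have "\<exists>k. parts_above \<alpha> k \<noteq> parts_above \<beta> k" using mset_eq_parts_above[OF comp(1,2)] ne by blast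
  then have k: "parts_above \<alpha> k \<noteq> parts_above \<beta> k" unfolding k_def by (rule LeastI_ex)
  have below: "parts_above \<alpha> j = parts_above \<beta> j" if "j < k" for j
    using not_less_Least[of j "\<lambda>k. parts_above \<alpha> k \<noteq> parts_above \<beta> k"] that by (auto simp: k_def)
  \<comment> \<open>At level 0 the numbers of rows are the lengths, which agree. So k is positive
    and the ribbon rows at level k share no column.\<close>
  have "0 < k" using k len comp by (cases k) (auto simp: parts_above_0)
  have *: "level_relation \<alpha> \<beta> \<nu> j \<and> (\<forall>i<j. parts_above \<nu> i = parts_above \<alpha> i)" if "j \<le> k" for j
    using that
  proof (induction j)
    case 0
    then show ?case using rel0 by simp
  next
    case (Suc j)
    then show ?case using level_relation_Suc[of \<alpha> \<beta> \<nu> j k] below[of j] k by (auto simp: less_Suc_eq)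
  qed
  have S: "(\<Sum>y\<leftarrow>\<alpha>. y - j) = (\<Sum>y\<leftarrow>\<nu>. y - j) \<and> (\<Sum>y\<leftarrow>\<beta>. y - j) = (\<Sum>y\<leftarrow>\<nu>. y - j)" if "j \<le> k" for j
    using that
  proof (induction j)
    case 0
    then show ?case using sums by simp
  next
    case (Suc j)
    then show ?case
      using sum_list_diff_Suc[where x = \<alpha> and k = j] sum_list_diff_Suc[where x = \<beta> and k = j]
        sum_list_diff_Suc[where x = \<nu> and k = j] *[of k] below[of j] by simp
  qed
  have rel: "cnt w (ribbon_level \<alpha> k) - cnt w (ribbon_level \<beta> k) = cnt w (young_level \<nu> k)" for w
    using *[of k] by (simp add: level_relation_def)
  note peel = cnt_level_peel[OF antitone_ribbon_start] cnt_level_peel[OF antitone_zero]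
    cnt_level_zero[OF antitone_ribbon_start] cnt_level_zero[OF antitone_zero]
  let ?p = "parts_above \<alpha> k" and ?q = "parts_above \<beta> k" and ?l = "parts_above \<nu> k"
  \<comment> \<open>Otherwise a letter of length q would annihilate \<alpha> only and make the
    difference negative for some word.\<close>
  have "\<not> ?p < ?q"
  proof
    assume "?p < ?q"
    moreover obtain w where "0 < cnt w (ribbon_level \<beta> (Suc k))" using cnt_level_pos[OF antitone_ribbon_start] .
    ultimately show False
      using rel[of "(False, ?q) # w"] cnt_nonneg[of "(False, ?q) # w" "young_level \<nu> k"]
      by (simp add: peel del: cnt.simps)
  qed
  then have qp: "?q < ?p" using k by simp
  have "\<not> ?p < ?l"
  proof
    assume "?p < ?l"
    moreover obtain w where "0 < cnt w (young_level \<nu> (Suc k))" using cnt_level_pos[OF antitone_zero] .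
    ultimately show False
      using rel[of "(False, ?l) # w"] qp by (simp add: peel del: cnt.simps)
  qed
  moreover have "\<not> ?l < ?p"
  proof
    assume "?l < ?p"
    moreover obtain w where "0 < cnt w (ribbon_level \<alpha> (Suc k))" using cnt_level_pos[OF antitone_ribbon_start] .
    ultimately show False
      using rel[of "(False, ?p) # w"] qp by (simp add: peel del: cnt.simps)
  qed
  ultimately have lp: "?l = ?p" by simp
  define X where "X = {A \<in> two_strips (young_level \<nu> k). card A = 1}"
  have X: "int ?p - int ?q = int (card X)"
    using level_relation_pairs(2)[of \<alpha> \<beta> \<nu> k 1] *[of k] \<open>0 < k\<close> comp
    by (simp only: card_two_strips_singleton_ribbon_level X_def)
  have "card X \<le> 1" unfolding X_def by (rule two_strips_singleton_young_level[OF \<nu>(2)])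
  then have pq: "?p = Suc ?q" and "card X = 1" using X qp by linarith+
  then have "X \<noteq> {}" by auto
  then have l2: "?l \<le> 2" and Sl: "parts_above \<nu> (Suc k) \<le> 1"
    using two_strips_singleton_young_level(2)[OF \<nu>(2), of k] unfolding X_def by blast+
  \<comment> \<open>The three diagrams have equally many cells at level k, and \<alpha> has a
    nonempty row there.\<close>
  have "?q \<noteq> 0"
  proof
    assume "?q = 0"
    then have "(\<Sum>y\<leftarrow>\<beta>. y - k) = 0" by (simp add: parts_above_eq_0_iff)
    then have "(\<Sum>y\<leftarrow>\<alpha>. y - k) = 0" using S[of k] by simp
    then show False using sum_list_diff_Suc[where x = \<alpha> and k = k] qp by simp
  qed
  then have p2: "?p = 2" "?q = 1" "?l = 2" using pq l2 lp by auto
  have "1 < length \<nu>" "k < \<nu> ! 1" using less_parts_above_iff[OF \<nu>(2), of 1 k] p2 by auto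
  then obtain a b S' where ab: "\<nu> = a # b # S'" and kb: "k < b"
    by (cases \<nu>; cases "tl \<nu>") auto
  have "b \<le> a" using \<nu>(2) ab by simp
  have "\<not> Suc k < b" using Sl \<open>b \<le> a\<close> ab by (auto split: if_splits)
  then have b: "b = Suc k" using kb by simp
  have S': "\<forall>y\<in>set S'. y \<le> k"
    using p2(3) kb \<open>b \<le> a\<close> unfolding ab by (simp add: parts_above_eq_0_iff)
  \<comment> \<open>A letter of length 2 annihilates \<beta>, which has only one row left, so from
    here on \<alpha> and \<nu> agree.\<close>
  have "cnt w (ribbon_level \<alpha> (Suc k)) = cnt w (young_level \<nu> (Suc k))" for w
    using rel[of "(False, 2) # w"] peel(1)[of \<alpha> k w] peel(2)[of \<nu> k w] p2
    by (simp add: peel del: cnt.simps)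
  then have "parts_above \<alpha> j = parts_above \<nu> j" if "Suc k \<le> j" for j
    by (rule level_eq_parts_above[OF antitone_ribbon_start antitone_zero _ that])
  then have "parts_above \<alpha> j = parts_above \<nu> j" for j
    using *[of k] lp by (metis Suc_leI linorder_neqE_nat order_refl)
  then have ma: "mset \<alpha> = mset \<nu>" by (rule mset_eq_parts_above[OF comp(1) \<nu>(1)])
  have "(\<Sum>y\<leftarrow>\<nu>. y - k) = a - k + 1"
  proof -
    have z: "(\<Sum>y\<leftarrow>S'. y - k) = 0" using S' by simp
    show ?thesis unfolding ab list.map sum_list.Cons z using b \<open>b \<le> a\<close> by simp
  qed
  \<comment> \<open>The one remaining row of \<beta> holds all a - k + 1 cells, so the part is k +
    (a - k + 1) = a + 1.\<close>
  then have Sb: "(\<Sum>y\<leftarrow>\<beta>. y - k) = a - k + 1" using S[of k] by simp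
  let ?y = "(a + 1) # (b - 1) # S'"
  have "parts_above \<beta> j = parts_above ?y j" for j
  proof (cases "j < k")
    case True
    then have "parts_above \<beta> j = parts_above \<nu> j" using below *[of k] by simp
    then show ?thesis using True b \<open>b \<le> a\<close> by (simp add: ab)
  next
    case False
    then have "parts_above \<beta> j = (if j < k + (a - k + 1) then 1 else 0)"
      using parts_above_le_1[of \<beta> k j] p2 Sb by simp
    moreover have "parts_above S' j = 0" using S' False by (auto simp: parts_above_eq_0_iff)
    ultimately show ?thesis using False b \<open>b \<le> a\<close> by simp
  qed
  moreover have "composition ?y" using \<nu>(1) b \<open>0 < k\<close> by (simp add: ab composition_def)
  ultimately have mb: "mset \<beta> = mset ?y" using comp(2) mset_eq_parts_above by blast
  have id: "map (\<lambda>x. Suc (x - 1)) x = x" if "composition x" for x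
    using that by (intro map_idI) (auto simp: composition_def)
  \<comment> \<open>At level 1 a part x leaves x - 1 cells and so x cuts: the fillings by two
    letters are counted by the product of the parts. A third row of \<nu> at this level would make
    the two products equal, but ab - (a + 1)(b - 1) = a - b + 1 is positive.\<close>
  have "parts_above S' 1 = 0"
  proof (rule ccontr)
    assume "parts_above S' 1 \<noteq> 0"
    then have "2 < parts_above \<nu> 1" using b \<open>0 < k\<close> \<open>b \<le> a\<close> by (simp add: ab)
    then have "two_strips (young_level \<nu> 1) = {}" by (rule two_strips_young_level_empty[OF \<nu>(2)])
    then have "int (prod_list \<alpha>) - int (prod_list \<beta>) = 0"
      using level_relation_pairs(1)[of \<alpha> \<beta> \<nu> 1] *[of 1] \<open>0 < k\<close> comp
      by (simp add: card_two_strips_ribbon_level id[unfolded One_nat_def])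
    then have "prod_list \<alpha> = prod_list \<beta>" by (simp only: right_minus_eq of_nat_eq_iff)
    moreover have "prod_list \<alpha> = a * b * prod_list S'" "prod_list \<beta> = (a + 1) * (b - 1) * prod_list S'"
      using ma mb by (simp_all add: prod_mset_prod_list[symmetric] ab algebra_simps)
    moreover have "prod_list S' \<noteq> 0" using \<nu>(1) by (auto simp: ab composition_def prod_list_zero_iff)
    ultimately have "a * b = (a + 1) * (b - 1)" by simp
    then show False using \<open>b \<le> a\<close> by (simp add: b)
  qed
  then have "\<forall>y\<in>set S'. y \<le> 1 \<and> 0 < y" using \<nu>(1) by (simp add: parts_above_eq_0_iff ab composition_def)
  then have "\<forall>y\<in>set S'. y = 1" by (metis One_nat_def Suc_leI le_antisym)
  then have "S' = replicate (length S') 1" by (metis replicate_length_same)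
  then have "\<nu> = [a, b] @ replicate (length S') 1" "mset \<alpha> = mset ([a, b] @ replicate (length S') 1)"
    "mset \<beta> = mset ([a + 1, b - 1] @ replicate (length S') 1)"
    using ma mb ab by simp_all
  then show ?thesis using that[of b a "length S'"] b \<open>0 < k\<close> \<open>b \<le> a\<close> by simp
qed

section \<open>Leaving out one row\<close>

definition omit :: "(nat \<Rightarrow> nat) \<Rightarrow> nat list \<Rightarrow> nat \<Rightarrow> cell set" where
  "omit s x r = shape (length x) (\<lambda>i. if i = r then s i else Suc (s i)) (\<lambda>i. s i + x ! i)"

definition omittable :: "(nat \<Rightarrow> nat) \<Rightarrow> nat list \<Rightarrow> nat set" where
  "omittable s x = {r. r < length x \<and> (\<forall>i. r < i \<and> i < length x \<longrightarrow> s i < s r)}"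

lemma finite_omit: "finite (omit s x r)"
  by (simp add: omit_def finite_shape)

lemma finite_omittable: "finite (omittable s x)"
  by (simp add: omittable_def)

lemma cnt_level_omit:
  assumes "antitone s (length x)" "composition x" "x \<noteq> []"
  shows "cnt ((False, length x - 1) # w) (level s x 0) = (\<Sum>r\<in>omittable s x. cnt w (omit s x r))"
  using cnt_shape_vertical_all_but_one[of "length x" s "\<lambda>i. s i + x ! i" w] assms
  by (simp add: level_def omit_def omittable_def antitone_def composition_def del: cnt.simps)

lemma card_omit_le: "card (omit s x r) \<le> card (level s x 0)"
  by (rule card_mono[OF finite_level]) (auto simp: omit_def level_def shape_def split: if_splits)

text \<open>Row r + 1 starts strictly to the left of row r exactly if its part exceeds 1, and the
  rows further down start no further right.\<close>

lemma omittable_ribbon: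
  assumes "composition \<alpha>"
  shows "omittable (ribbon_start \<alpha>) \<alpha> = {r. r < length \<alpha> \<and> (Suc r < length \<alpha> \<longrightarrow> 2 \<le> \<alpha> ! Suc r)}"
proof -
  have "(\<forall>i. r < i \<and> i < length \<alpha> \<longrightarrow> ribbon_start \<alpha> i < ribbon_start \<alpha> r) \<longleftrightarrow>
      (Suc r < length \<alpha> \<longrightarrow> 2 \<le> \<alpha> ! Suc r)" (is "?l \<longleftrightarrow> ?r") for r
  proof
    assume ?l
    then show ?r using ribbon_start_Suc[OF assms, of r] by auto
  next
    assume r: ?r
    show ?l
    proof (intro allI impI)
      fix i assume i: "r < i \<and> i < length \<alpha>"
      then have "ribbon_start \<alpha> i \<le> ribbon_start \<alpha> (Suc r)"
        using antitone_ribbon_start[of \<alpha> "length \<alpha>"] by (auto simp: antitone_def)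
      then show "ribbon_start \<alpha> i < ribbon_start \<alpha> r"
        using ribbon_start_Suc[OF assms, of r] r i by auto
    qed
  qed
  then show ?thesis by (simp add: omittable_def)
qed

text \<open>The first cell kept in row r lies above the last cell of row r + 1 and shares no other
  column. This forces one cell in each of the two rows: row r keeps as many cuts as its part, row r
  + 1 loses one. The last row has nothing below it and gains a cut.\<close>

lemma card_two_strips_omit_ribbon:
  assumes comp: "composition \<alpha>" and r: "r \<in> omittable (ribbon_start \<alpha>) \<alpha>"
  shows "real (card (two_strips (omit (ribbon_start \<alpha>) \<alpha> r))) = real (prod_list \<alpha>) *
    (if Suc r < length \<alpha> then 1 - 1 / real (\<alpha> ! Suc r) else 1 + 1 / real (\<alpha> ! r))"
proof -
  let ?s = "ribbon_start \<alpha>" and ?R = "length \<alpha>"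
  let ?t = "\<lambda>i. if i = r then ?s i else Suc (?s i)" and ?u = "\<lambda>i. ?s i + \<alpha> ! i"
  let ?D = "shape ?R ?t ?u"
  have r: "r < ?R" "Suc r < ?R \<Longrightarrow> 2 \<le> \<alpha> ! Suc r" using r by (auto simp: omittable_ribbon[OF comp])
  have pos: "0 < \<alpha> ! i" if "i < ?R" for i using comp that by (simp add: composition_def)
  \<comment> \<open>The ranges of the cuts after the forced overlap: row r is cut after its first
    cell, row r + 1 before its last.\<close>
  define lo where "lo i = (if i = r \<and> Suc r < ?R then Suc (?s r) else ?t i)" for i
  define hi where "hi i = (if i = Suc r then ?s r else ?u i)" for i
  have s_Suc: "Suc (?s r) = ?s (Suc r) + \<alpha> ! Suc r" if "Suc r < ?R"
    using ribbon_start_Suc[OF comp that] .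
  have collision: "i = r \<and> i' = Suc r \<and> j = ?s r" if "i < i'" "(i, j) \<in> ?D" "(i', j) \<in> ?D" for i i' j
  proof -
    have ij: "i < ?R" "i' < ?R" "?t i \<le> j" "?t i' \<le> j" "j < ?u i'" using that by (auto simp: shape_def)
    have e: "?u i' \<le> Suc (?s i)" using ribbon_end_le[OF comp \<open>i < i'\<close> \<open>i' < ?R\<close>] .
    then have "i = r" using ij by (auto split: if_splits)
    moreover from this have "j = ?s r" using ij e by auto
    moreover have "i' = Suc r"
    proof (rule ccontr)
      assume "i' \<noteq> Suc r"
      then have "Suc r < i'" using \<open>i = r\<close> \<open>i < i'\<close> by simp
      then have "?u i' \<le> Suc (?s (Suc r))" using ribbon_end_le[OF comp _ \<open>i' < ?R\<close>] by simp
      moreover have "?s (Suc r) < ?s r" using s_Suc r \<open>Suc r < i'\<close> ij by auto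
      ultimately show False using ij \<open>j = ?s r\<close> by simp
    qed
    ultimately show ?thesis by simp
  qed
  have collides: "(r, ?s r) \<in> ?D" "(Suc r, ?s r) \<in> ?D" if "Suc r < ?R"
    using that r s_Suc pos[of r] pos[of "Suc r"] by (auto simp: shape_def)
  have "{f \<in> (\<Pi>\<^sub>E i\<in>{..<?R}. {?t i..max (?t i) (?u i)}).
     \<forall>i i' j. i < i' \<and> (i, j) \<in> ?D \<and> (i', j) \<in> ?D \<longrightarrow> f i' \<le> j \<and> j < f i} = (\<Pi>\<^sub>E i\<in>{..<?R}. {lo i..hi i})"
    (is "?L = ?P")
  proof (intro subset_antisym subsetI)
    fix f assume f: "f \<in> ?L"
    then have fP: "f \<in> (\<Pi>\<^sub>E i\<in>{..<?R}. {?t i..max (?t i) (?u i)})" by blast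
    have c: "f (Suc r) \<le> ?s r \<and> ?s r < f r" if "Suc r < ?R" using f collides[OF that] by blast
    have "f i \<in> {lo i..hi i}" if "i < ?R" for i
    proof -
      have "?t i \<le> f i" "f i \<le> max (?t i) (?u i)" using PiE_mem[OF fP, of i] that by auto
      then show ?thesis using c that pos[OF that] by (auto simp: lo_def hi_def max_def split: if_splits)
    qed
    then show "f \<in> ?P" using fP by (auto simp: PiE_iff)
  next
    fix f assume f: "f \<in> ?P"
    have fi: "lo i \<le> f i" "f i \<le> hi i" if "i < ?R" for i using PiE_mem[OF f, of i] that by auto
    have "f i \<in> {?t i..max (?t i) (?u i)}" if "i < ?R" for i
    proof -
      have "?t i \<le> lo i" by (auto simp: lo_def)
      moreover have "hi i \<le> ?u i" using s_Suc that by (auto simp: hi_def)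
      ultimately show ?thesis using fi[OF that] by auto
    qed
    then have "f \<in> (\<Pi>\<^sub>E i\<in>{..<?R}. {?t i..max (?t i) (?u i)})" using f by (auto simp: PiE_iff)
    moreover have "f i' \<le> j \<and> j < f i" if "i < i'" "(i, j) \<in> ?D" "(i', j) \<in> ?D" for i i' j
    proof -
      have c: "i = r" "i' = Suc r" "j = ?s r" using collision[OF that] by auto
      have "Suc r < ?R" using that(3) c by (auto simp: shape_def)
      then show ?thesis using fi[of r] fi[of "Suc r"] c by (simp add: lo_def hi_def)
    qed
    ultimately show "f \<in> ?L" by blast
  qed
  then have "card (two_strips ?D) = (\<Prod>i<?R. Suc (hi i) - lo i)"
    by (simp add: card_two_strips_shape card_PiE)
  also have "real \<dots> = (\<Prod>i<?R. real (\<alpha> ! i) * (if Suc r < ?R then (if i = Suc r then 1 - 1 / real (\<alpha> ! Suc r) else 1)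
      else (if i = r then 1 + 1 / real (\<alpha> ! r) else 1)))"
    unfolding of_nat_prod
  proof (rule prod.cong)
    fix i assume "i \<in> {..<?R}"
    then have "i < ?R" by simp
    then show "real (Suc (hi i) - lo i) = real (\<alpha> ! i) * (if Suc r < ?R then (if i = Suc r then 1 - 1 / real (\<alpha> ! Suc r) else 1)
      else (if i = r then 1 + 1 / real (\<alpha> ! r) else 1))"
    proof (cases "Suc r < ?R")
      case True
      have "Suc (hi (Suc r)) - lo (Suc r) = \<alpha> ! Suc r - 1"
        using s_Suc[OF True] by (simp add: hi_def lo_def)
      then have "real (Suc (hi (Suc r)) - lo (Suc r)) = real (\<alpha> ! Suc r) * (1 - 1 / real (\<alpha> ! Suc r))"
        using pos[OF True] by (simp add: of_nat_diff field_simps)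
      moreover have "Suc (hi i) - lo i = \<alpha> ! i" if "i \<noteq> Suc r"
        using that True by (auto simp: hi_def lo_def)
      ultimately show ?thesis using True by (cases "i = Suc r") auto
    next
      case False
      then have "i \<noteq> Suc r" using \<open>i < ?R\<close> by auto
      then show ?thesis using False pos[OF \<open>i < ?R\<close>] by (auto simp: hi_def lo_def field_simps of_nat_diff)
    qed
  qed simp
  also have "\<dots> = real (prod_list \<alpha>) *
    (if Suc r < length \<alpha> then 1 - 1 / real (\<alpha> ! Suc r) else 1 + 1 / real (\<alpha> ! r))"
    using prod_list_nth[of "\<lambda>x. x" \<alpha>] r(1) by (simp add: prod.distrib prod.delta del: of_nat_prod flip: of_nat_prod)
  finally show ?thesis by (simp add: omit_def)
qed

text \<open>A row that cannot be left out is followed by a part 1, for which 1 - 1/1 = 0, so the sum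
  may run over all rows. Every part but the first then occurs as the part of a next row, and the
  last one once more on its own.\<close>

lemma sum_card_two_strips_omit_ribbon:
  assumes comp: "composition \<alpha>" and "\<alpha> \<noteq> []"
  shows "(\<Sum>r\<in>omittable (ribbon_start \<alpha>) \<alpha>. real (card (two_strips (omit (ribbon_start \<alpha>) \<alpha> r)))) =
    real (prod_list \<alpha>) * (real (length \<alpha>) + 1 / real (hd \<alpha>) + 1 / real (last \<alpha>) - (\<Sum>x\<leftarrow>\<alpha>. 1 / real x))"
proof -
  obtain n where n: "length \<alpha> = Suc n" using \<open>\<alpha> \<noteq> []\<close> by (cases "length \<alpha>") auto
  let ?g = "\<lambda>r. if Suc r < length \<alpha> then 1 - 1 / real (\<alpha> ! Suc r) else 1 + 1 / real (\<alpha> ! r)"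
  have "(\<Sum>r\<in>omittable (ribbon_start \<alpha>) \<alpha>. real (card (two_strips (omit (ribbon_start \<alpha>) \<alpha> r)))) =
      (\<Sum>r\<in>omittable (ribbon_start \<alpha>) \<alpha>. real (prod_list \<alpha>) * ?g r)"
    using card_two_strips_omit_ribbon[OF comp] by (intro sum.cong) auto
  also have "\<dots> = (\<Sum>r<Suc n. real (prod_list \<alpha>) * ?g r)"
  proof (rule sum.mono_neutral_left)
    show "\<forall>r\<in>{..<Suc n} - omittable (ribbon_start \<alpha>) \<alpha>. real (prod_list \<alpha>) * ?g r = 0"
    proof
      fix r assume "r \<in> {..<Suc n} - omittable (ribbon_start \<alpha>) \<alpha>"
      then have "Suc r < length \<alpha>" "\<not> 2 \<le> \<alpha> ! Suc r" using n by (auto simp: omittable_ribbon[OF comp])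
      moreover from this have "0 < \<alpha> ! Suc r" using comp by (simp add: composition_def)
      ultimately have "Suc r < length \<alpha>" "\<alpha> ! Suc r = 1" by auto
      then show "real (prod_list \<alpha>) * ?g r = 0" by simp
    qed
  qed (auto simp: omittable_def n)
  also have "\<dots> = real (prod_list \<alpha>) * (\<Sum>r<Suc n. ?g r)" by (simp only: sum_distrib_left)
  also have "(\<Sum>r<Suc n. ?g r) = (\<Sum>r<n. 1 - 1 / real (\<alpha> ! Suc r)) + (1 + 1 / real (last \<alpha>))"
    using \<open>\<alpha> \<noteq> []\<close> by (simp add: n last_conv_nth)
  also have "(\<Sum>r<n. 1 - 1 / real (\<alpha> ! Suc r)) = real n - (\<Sum>r<n. 1 / real (\<alpha> ! Suc r))"
    by (simp add: sum_subtractf)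
  also have "(\<Sum>r<n. 1 / real (\<alpha> ! Suc r)) = (\<Sum>x\<leftarrow>\<alpha>. 1 / real x) - 1 / real (hd \<alpha>)"
  proof -
    have "(\<Sum>x\<leftarrow>\<alpha>. 1 / real x) = (\<Sum>i<Suc n. 1 / real (\<alpha> ! i))"
      by (simp add: sum_list_sum_nth n atLeast0LessThan del: sum.lessThan_Suc)
    also have "\<dots> = 1 / real (\<alpha> ! 0) + (\<Sum>i<n. 1 / real (\<alpha> ! Suc i))" by (rule sum.lessThan_Suc_shift)
    finally show ?thesis using \<open>\<alpha> \<noteq> []\<close> by (simp add: hd_conv_nth)
  qed
  finally show ?thesis by (simp add: n algebra_simps)
qed

section \<open>Blocks of ones\<close>

primrec one_blocks :: "nat list \<Rightarrow> nat" where
  "one_blocks [] = 0"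
| "one_blocks (x # xs) = (if x = 1 \<and> (xs = [] \<or> 2 \<le> hd xs) then 1 else 0) + one_blocks xs"

text \<open>Each maximal run of ones is counted at its last element, and these are the parts 1 in
  rows that can be left out.\<close>

lemma one_blocks_card:
  "one_blocks x = card {r. r < length x \<and> (Suc r < length x \<longrightarrow> 2 \<le> x ! Suc r) \<and> x ! r = 1}"
proof (induction x)
  case (Cons y ys)
  let ?S = "{r. r < length ys \<and> (Suc r < length ys \<longrightarrow> 2 \<le> ys ! Suc r) \<and> ys ! r = 1}"
  have "{r. r < length (y # ys) \<and> (Suc r < length (y # ys) \<longrightarrow> 2 \<le> (y # ys) ! Suc r) \<and> (y # ys) ! r = 1} =
    (if y = 1 \<and> (ys = [] \<or> 2 \<le> hd ys) then {0} else {}) \<union> Suc ` ?S" (is "?A = ?B")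
  proof (rule set_eqI)
    fix r show "r \<in> ?A \<longleftrightarrow> r \<in> ?B"
      by (cases r) (auto simp: hd_conv_nth)
  qed
  then show ?case using Cons by (simp add: card_image card_Un_disjoint)
qed simp

text \<open>After the omission the nonempty rows are those of the parts above 1 together with row r.
  With at most two large parts, the letter of length 3 finds three rows only if there are two of
  them and row r is a part 1.\<close>

lemma sum_cnt_omit_ribbon:
  assumes comp: "composition \<alpha>" and r: "r \<in> omittable (ribbon_start \<alpha>) \<alpha>"
    and two: "parts_above \<alpha> 1 \<le> 2" and M: "card (omit (ribbon_start \<alpha>) \<alpha> r) \<le> M"
  shows "(\<Sum>j\<le>M. \<Sum>m\<le>M. cnt [(False, 3), (True, j), (True, m)] (omit (ribbon_start \<alpha>) \<alpha> r)) =
    (if \<alpha> ! r = 1 \<and> parts_above \<alpha> 1 = 2 then int (prod_list (map (\<lambda>x. Suc (x - 2)) \<alpha>)) else 0)"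
proof -
  let ?s = "ribbon_start \<alpha>" and ?R = "length \<alpha>"
  let ?t = "\<lambda>i. if i = r then ?s i else Suc (?s i)" and ?u = "\<lambda>i. ?s i + \<alpha> ! i"
  have rR: "r < ?R" and less: "\<And>i. r < i \<Longrightarrow> i < ?R \<Longrightarrow> ?s i < ?s r" using r by (auto simp: omittable_def)
  have pos: "0 < \<alpha> ! i" if "i < ?R" for i using comp that by (simp add: composition_def)
  have anti: "?t i \<le> ?t i'" if "i' \<le> i" "i < ?R" for i i'
  proof -
    have "?s i \<le> ?s i'" using antitone_ribbon_start[of \<alpha> ?R] that by (simp add: antitone_def)
    then show ?thesis using less[of i] that by (cases "i' = i") auto
  qed
  have "rows ?R ?t ?u = insert r {i. i < ?R \<and> 1 < \<alpha> ! i}"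
    using pos rR by (auto simp: rows_def split: if_splits)
  then have rows: "card (rows ?R ?t ?u) = parts_above \<alpha> 1 + (if \<alpha> ! r = 1 then 1 else 0)"
    using pos[OF rR] rR by (auto simp: card_insert_if parts_above_def length_filter_conv_card)
  show ?thesis
  proof (cases "\<alpha> ! r = 1 \<and> parts_above \<alpha> 1 = 2")
    case True
    let ?E = "shape ?R (\<lambda>i. Suc (?t i)) ?u"
    have peel: "cnt ((False, 3) # w) (omit ?s \<alpha> r) = cnt w ?E" for w
      using cnt_shape_vertical_all[of ?R ?t ?u w] anti rows True by (simp add: omit_def del: cnt.simps)
    have "card ?E \<le> M"
      by (rule order_trans[OF card_mono[OF finite_omit] M]) (auto simp: omit_def shape_def)
    then have "(\<Sum>j\<le>M. \<Sum>m\<le>M. cnt [(False, 3), (True, j), (True, m)] (omit ?s \<alpha> r)) = int (card (two_strips ?E))"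
      by (simp only: peel sum_cnt_pairs[OF finite_shape])
    also have "card (two_strips ?E) = (\<Prod>i<?R. Suc (?u i - Suc (?t i)))"
    proof (rule card_two_strips_columns_disjoint)
      fix i i' j assume "i < i'" "(i, j) \<in> ?E" "(i', j) \<in> ?E"
      then show False using ribbon_end_le[OF comp, of i i'] by (auto simp: shape_def split: if_splits)
    qed
    \<comment> \<open>A part 1 leaves no cell, in row r as elsewhere; truncated subtraction gives it
      the factor \<open>Suc (1 - 2)\<close>, which is 1.\<close>
    also have "\<dots> = (\<Prod>i<?R. Suc (\<alpha> ! i - 2))"
      using True by (intro prod.cong) auto
    finally show ?thesis using True by (simp add: prod_list_nth)
  next
    case False
    then have "card (rows ?R ?t ?u) < 3" using rows two by auto
    then have "cnt ((False, 3) # w) (omit ?s \<alpha> r) = 0" for w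
      using cnt_shape_vertical_zero[of ?R ?t ?u 3 w] anti by (simp add: omit_def del: cnt.simps)
    then show ?thesis unfolding if_not_P[OF False] by (simp del: cnt.simps)
  qed
qed

lemma sum_omittable_cnt_ribbon:
  assumes comp: "composition \<alpha>" and two: "parts_above \<alpha> 1 \<le> 2" and M: "card (ribbon_level \<alpha> 0) \<le> M"
  shows "(\<Sum>r\<in>omittable (ribbon_start \<alpha>) \<alpha>.
      \<Sum>j\<le>M. \<Sum>m\<le>M. cnt [(False, 3), (True, j), (True, m)] (omit (ribbon_start \<alpha>) \<alpha> r)) =
    (if parts_above \<alpha> 1 = 2 then int (one_blocks \<alpha> * prod_list (map (\<lambda>x. Suc (x - 2)) \<alpha>)) else 0)"
proof -
  let ?s = "ribbon_start \<alpha>"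
  have M: "card (omit ?s \<alpha> r) \<le> M" for r using card_omit_le[of ?s \<alpha> r] M by simp
  have "one_blocks \<alpha> = card {r \<in> omittable ?s \<alpha>. \<alpha> ! r = 1}"
    by (simp add: one_blocks_card omittable_ribbon[OF comp] conj_assoc)
  then show ?thesis
    by (simp add: sum_cnt_omit_ribbon[OF comp _ two M] finite_omittable sum.If_cases Int_def del: cnt.simps)
qed

lemma sum_cnt_level_omit:
  assumes "antitone s (length x)" "composition x" "x \<noteq> []"
  shows "(\<Sum>j\<le>M. \<Sum>m\<le>M. cnt ((False, length x - 1) # u @ [(True, j), (True, m)]) (level s x 0)) =
    (\<Sum>r\<in>omittable s x. \<Sum>j\<le>M. \<Sum>m\<le>M. cnt (u @ [(True, j), (True, m)]) (omit s x r))"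
proof -
  have "(\<Sum>j\<le>M. \<Sum>m\<le>M. cnt ((False, length x - 1) # u @ [(True, j), (True, m)]) (level s x 0)) =
      (\<Sum>j\<le>M. \<Sum>m\<le>M. \<Sum>r\<in>omittable s x. cnt (u @ [(True, j), (True, m)]) (omit s x r))"
    by (simp only: cnt_level_omit[OF assms])
  also have "\<dots> = (\<Sum>j\<le>M. \<Sum>r\<in>omittable s x. \<Sum>m\<le>M. cnt (u @ [(True, j), (True, m)]) (omit s x r))"
    by (intro sum.cong refl sum.swap)
  also have "\<dots> = (\<Sum>r\<in>omittable s x. \<Sum>j\<le>M. \<Sum>m\<le>M. cnt (u @ [(True, j), (True, m)]) (omit s x r))"
    by (rule sum.swap)
  finally show ?thesis .
qed

lemma sum_cnt_level_omit_pairs: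
  assumes "antitone s (length x)" "composition x" "x \<noteq> []" "card (level s x 0) \<le> M"
  shows "(\<Sum>j\<le>M. \<Sum>m\<le>M. cnt [(False, length x - 1), (True, j), (True, m)] (level s x 0)) =
    (\<Sum>r\<in>omittable s x. int (card (two_strips (omit s x r))))"
proof -
  have "card (omit s x r) \<le> M" for r using card_omit_le[of s x r] assms(4) by simp
  then have "(\<Sum>j\<le>M. \<Sum>m\<le>M. cnt [(True, j), (True, m)] (omit s x r)) = int (card (two_strips (omit s x r)))" for r
    by (rule sum_cnt_pairs[OF finite_omit])
  then show ?thesis
    using sum_cnt_level_omit[OF assms(1-3), where M = M and u = "[]"] by (simp only: append_Nil)
qed

section \<open>Leaving out one row of the Young diagram\<close>

lemma omittable_zero: "x \<noteq> [] \<Longrightarrow> omittable (\<lambda>_. 0) x = {length x - 1}"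
proof -
  assume "x \<noteq> []"
  then have "r < length x \<and> (\<forall>i. r < i \<longrightarrow> \<not> i < length x) \<longleftrightarrow> r = length x - 1" for r
    by (cases "length x") (auto simp: less_Suc_eq_le dest: spec[of _ "Suc r"])
  then show ?thesis by (auto simp: omittable_def)
qed

lemma young_nth:
  assumes "i < Suc (Suc d)"
  shows "([a, b] @ replicate d 1) ! i = (if i = 0 then a else if i = 1 then b else (1::nat))"
  using assms by (auto simp: nth_Cons' )

text \<open>What remains is a two-row diagram and, apart from it, the lowest cell of column 0. The
  columns 1 to b - 1 of the two rows are forced, so the upper row has a - b + 1 cuts; the isolated
  cell contributes the factor 2.\<close>

lemma card_two_strips_omit_young:
  assumes "2 \<le> b" "b \<le> a" "1 \<le> d"
  shows "card (two_strips (omit (\<lambda>_. 0) ([a, b] @ replicate d 1) (Suc d))) = 2 * (a - b + 1)"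
proof -
  let ?R = "Suc (Suc d)"
  let ?t = "\<lambda>i. if i = Suc d then 0 else Suc 0"
    and ?u = "\<lambda>i. if i = 0 then a else if i = 1 then b else 1"
  let ?D = "shape ?R ?t ?u"
  define lo where "lo i = (if i = 0 then b else ?t i)" for i
  define hi where "hi i = (if i = 0 then a else 1)" for i :: nat
  have D: "omit (\<lambda>_. 0) ([a, b] @ replicate d 1) (Suc d) = ?D"
    by (auto simp: omit_def shape_def young_nth[unfolded One_nat_def] simp del: append_Cons append_Nil split: if_splits)
  have "{f \<in> (\<Pi>\<^sub>E i\<in>{..<?R}. {?t i..max (?t i) (?u i)}).
     \<forall>i i' j. i < i' \<and> (i, j) \<in> ?D \<and> (i', j) \<in> ?D \<longrightarrow> f i' \<le> j \<and> j < f i} = (\<Pi>\<^sub>E i\<in>{..<?R}. {lo i..hi i})"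
    (is "?L = ?P")
  proof (intro subset_antisym subsetI)
    fix f assume f: "f \<in> ?L"
    then have fP: "f \<in> (\<Pi>\<^sub>E i\<in>{..<?R}. {?t i..max (?t i) (?u i)})" by blast
    have c: "f 1 \<le> j \<and> j < f 0" if "1 \<le> j" "j < b" for j
    proof -
      have "(0, j) \<in> ?D" "(1, j) \<in> ?D" using that assms by (auto simp: shape_def)
      moreover have "\<forall>i i' j. i < i' \<and> (i, j) \<in> ?D \<and> (i', j) \<in> ?D \<longrightarrow> f i' \<le> j \<and> j < f i"
        using f by (elim CollectE conjE)
      ultimately show ?thesis using zero_less_one by blast
    qed
    have "f i \<in> {lo i..hi i}" if "i < ?R" for i
    proof -
      have "?t i \<le> f i" "f i \<le> max (?t i) (?u i)" using PiE_mem[OF fP, of i] that by auto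
      moreover have "f 1 \<le> 1" "b \<le> f 0" using c[of 1] c[of "b - 1"] assms by linarith+
      ultimately show ?thesis using assms that by (auto simp: lo_def hi_def max_def split: if_splits)
    qed
    then show "f \<in> ?P" using fP by (auto simp: PiE_iff)
  next
    fix f assume f: "f \<in> ?P"
    have fi: "lo i \<le> f i" "f i \<le> hi i" if "i < ?R" for i using PiE_mem[OF f, of i] that by auto
    have "f i \<in> {?t i..max (?t i) (?u i)}" if "i < ?R" for i
    proof -
      have "?t i \<le> lo i" "hi i \<le> max (?t i) (?u i)" using assms by (auto simp: lo_def hi_def)
      then show ?thesis using fi[OF that] by auto
    qed
    then have "f \<in> (\<Pi>\<^sub>E i\<in>{..<?R}. {?t i..max (?t i) (?u i)})" using f by (auto simp: PiE_iff)
    moreover have "f i' \<le> j \<and> j < f i" if "i < i'" "(i, j) \<in> ?D" "(i', j) \<in> ?D" for i i' j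
    proof -
      have "i = 0" "i' = 1" "1 \<le> j" "j < b" using that assms by (auto simp: shape_def split: if_splits)
      then show ?thesis using fi[of 0] fi[of 1] assms by (simp add: lo_def hi_def)
    qed
    ultimately show "f \<in> ?L" by blast
  qed
  then have "card (two_strips ?D) = (\<Prod>i<?R. Suc (hi i) - lo i)"
    by (simp add: card_two_strips_shape card_PiE del: prod.lessThan_Suc)
  also have "\<dots> = (\<Prod>i<?R. (if i = 0 then a - b + 1 else 1) * (if i = Suc d then 2 else 1))"
    using assms by (intro prod.cong) (auto simp: hi_def lo_def)
  also have "\<dots> = 2 * (a - b + 1)"
    by (simp add: prod.distrib prod.delta del: prod.lessThan_Suc)
  finally show ?thesis by (simp only: D)
qed

text \<open>The letter of length 3 takes the isolated cell and one cell of each long row. The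
  difference of the two row lengths, and with it the factor a - b + 1, is unchanged.\<close>

lemma sum_cnt_omit_young:
  assumes "2 \<le> b" "b \<le> a" "1 \<le> d"
    and M: "card (omit (\<lambda>_. 0) ([a, b] @ replicate d 1) (Suc d)) \<le> M"
  shows "(\<Sum>j\<le>M. \<Sum>m\<le>M. cnt [(False, 3), (True, j), (True, m)]
    (omit (\<lambda>_. 0) ([a, b] @ replicate d 1) (Suc d))) = int (a - b + 1)"
proof -
  let ?R = "Suc (Suc d)"
  let ?t = "\<lambda>i. if i = Suc d then 0 else Suc 0"
    and ?u = "\<lambda>i. if i = 0 then a else if i = 1 then b else 1"
  let ?t' = "\<lambda>i. Suc (?t i)"
  let ?D = "shape ?R ?t ?u" and ?E = "shape ?R ?t' ?u"
  have D: "omit (\<lambda>_. 0) ([a, b] @ replicate d 1) (Suc d) = ?D"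
    by (auto simp: omit_def shape_def young_nth[unfolded One_nat_def] simp del: append_Cons append_Nil split: if_splits)
  have "rows ?R ?t ?u = {0, 1, Suc d}" using assms by (auto simp: rows_def split: if_splits)
  then have rows: "card (rows ?R ?t ?u) = 3" using assms by simp
  have peel: "cnt ((False, 3) # w) ?D = cnt w ?E" for w
    using cnt_shape_vertical_all[of ?R ?t ?u w] rows by (simp del: cnt.simps)
  have "?E \<subseteq> ?D" by (auto simp: shape_def)
  then have "card ?E \<le> card ?D" by (rule card_mono[OF finite_shape])
  also have "\<dots> \<le> M" using M unfolding D .
  finally have "card ?E \<le> M" .
  then have sum: "(\<Sum>j\<le>M. \<Sum>m\<le>M. cnt [(False, 3), (True, j), (True, m)] ?D) = int (card (two_strips ?E))"
    by (simp only: peel sum_cnt_pairs[OF finite_shape])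
  define lo where "lo i = (if i = 0 then b else ?t' i)" for i
  define hi where "hi i = (if i = 0 then a else ?t' i)" for i
  have "{f \<in> (\<Pi>\<^sub>E i\<in>{..<?R}. {?t' i..max (?t' i) (?u i)}).
     \<forall>i i' j. i < i' \<and> (i, j) \<in> ?E \<and> (i', j) \<in> ?E \<longrightarrow> f i' \<le> j \<and> j < f i} = (\<Pi>\<^sub>E i\<in>{..<?R}. {lo i..hi i})"
    (is "?L = ?P")
  proof (intro subset_antisym subsetI)
    fix f assume f: "f \<in> ?L"
    then have fP: "f \<in> (\<Pi>\<^sub>E i\<in>{..<?R}. {?t' i..max (?t' i) (?u i)})" by blast
    have c: "f 1 \<le> j \<and> j < f 0" if "2 \<le> j" "j < b" for j
    proof -
      have "(0, j) \<in> ?E" "(1, j) \<in> ?E" using that assms by (auto simp: shape_def)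
      moreover have "\<forall>i i' j. i < i' \<and> (i, j) \<in> ?E \<and> (i', j) \<in> ?E \<longrightarrow> f i' \<le> j \<and> j < f i"
        using f by (elim CollectE conjE)
      ultimately show ?thesis using zero_less_one by blast
    qed
    have "f i \<in> {lo i..hi i}" if "i < ?R" for i
    proof -
      have "?t' i \<le> f i" "f i \<le> max (?t' i) (?u i)" using PiE_mem[OF fP, of i] that by auto
      \<comment> \<open>For b = 2 the lower row is used up and no column is shared; the bound
        \<open>b\<close> for the upper cut then holds because that row starts in column 2.\<close>
      moreover have "b = 2 \<or> f 1 \<le> 2 \<and> b \<le> f 0" using c[of 2] c[of "b - 1"] assms by linarith
      ultimately show ?thesis using assms that by (auto simp: lo_def hi_def max_def split: if_splits)
    qed
    then show "f \<in> ?P" using fP by (auto simp: PiE_iff)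
  next
    fix f assume f: "f \<in> ?P"
    have fi: "lo i \<le> f i" "f i \<le> hi i" if "i < ?R" for i using PiE_mem[OF f, of i] that by auto
    have "f i \<in> {?t' i..max (?t' i) (?u i)}" if "i < ?R" for i
    proof -
      have "?t' i \<le> lo i" "hi i \<le> max (?t' i) (?u i)" using assms by (auto simp: lo_def hi_def)
      then show ?thesis using fi[OF that] by auto
    qed
    then have "f \<in> (\<Pi>\<^sub>E i\<in>{..<?R}. {?t' i..max (?t' i) (?u i)})" using f by (auto simp: PiE_iff)
    moreover have "f i' \<le> j \<and> j < f i" if "i < i'" "(i, j) \<in> ?E" "(i', j) \<in> ?E" for i i' j
    proof -
      have "i = 0" "i' = 1" "2 \<le> j" "j < b" using that assms by (auto simp: shape_def split: if_splits)
      then show ?thesis using fi[of 0] fi[of 1] assms by (simp add: lo_def hi_def)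
    qed
    ultimately show "f \<in> ?L" by blast
  qed
  then have "card (two_strips ?E) = (\<Prod>i<?R. Suc (hi i) - lo i)"
    by (simp add: card_two_strips_shape card_PiE del: prod.lessThan_Suc)
  also have "\<dots> = (\<Prod>i<?R. if i = 0 then a - b + 1 else 1)"
    using assms by (intro prod.cong) (auto simp: hi_def lo_def)
  also have "\<dots> = a - b + 1"
    by (simp add: prod.delta del: prod.lessThan_Suc)
  finally show ?thesis using sum by (simp only: D)
qed

text \<open>All rows of \<nu> start in column 0, so only its last row can be left out, which
  explains the simple right-hand sides. For d \<ge> 1 this row is a part 1.\<close>

lemma omit_relations:
  assumes comp: "composition \<alpha>" "composition \<beta>" and ab: "2 \<le> b" "b \<le> a" "1 \<le> d"
    and len: "length \<alpha> = d + 2" "length \<beta> = d + 2"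
    and two: "parts_above \<alpha> 1 \<le> 2" "parts_above \<beta> 1 \<le> 2"
    and rel: "level_relation \<alpha> \<beta> ([a, b] @ replicate d 1) 0"
  shows "real (prod_list \<alpha>) * (real (d + 2) + 1 / real (hd \<alpha>) + 1 / real (last \<alpha>) - (\<Sum>x\<leftarrow>\<alpha>. 1 / real x))
    - real (prod_list \<beta>) * (real (d + 2) + 1 / real (hd \<beta>) + 1 / real (last \<beta>) - (\<Sum>x\<leftarrow>\<beta>. 1 / real x))
    = 2 * (real a - real b + 1)"
    and "(if parts_above \<alpha> 1 = 2 then int (one_blocks \<alpha> * prod_list (map (\<lambda>x. Suc (x - 2)) \<alpha>)) else 0)
    - (if parts_above \<beta> 1 = 2 then int (one_blocks \<beta> * prod_list (map (\<lambda>x. Suc (x - 2)) \<beta>)) else 0)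
    = int (a - b + 1)"
proof -
  let ?\<nu> = "[a, b] @ replicate d 1"
  define M where "M = card (ribbon_level \<alpha> 0) + card (ribbon_level \<beta> 0) + card (young_level ?\<nu> 0)"
  have M: "card (ribbon_level \<alpha> 0) \<le> M" "card (ribbon_level \<beta> 0) \<le> M" "card (young_level ?\<nu> 0) \<le> M"
    by (auto simp: M_def)
  have ne: "\<alpha> \<noteq> []" "\<beta> \<noteq> []" using len by auto
  have \<nu>: "composition ?\<nu>" "?\<nu> \<noteq> []" "length ?\<nu> = d + 2" using ab by (auto simp: composition_def)
  have om: "omittable (\<lambda>_. 0) ?\<nu> = {Suc d}" using omittable_zero[OF \<nu>(2)] by simp
  have rel: "cnt w (young_level ?\<nu> 0) = cnt w (ribbon_level \<alpha> 0) - cnt w (ribbon_level \<beta> 0)" for w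
    using rel by (simp add: level_relation_def)
  have S: "(\<Sum>j\<le>M. \<Sum>m\<le>M. cnt ((False, d + 1) # u @ [(True, j), (True, m)]) (young_level ?\<nu> 0)) =
      (\<Sum>j\<le>M. \<Sum>m\<le>M. cnt ((False, d + 1) # u @ [(True, j), (True, m)]) (ribbon_level \<alpha> 0)) -
      (\<Sum>j\<le>M. \<Sum>m\<le>M. cnt ((False, d + 1) # u @ [(True, j), (True, m)]) (ribbon_level \<beta> 0))" for u
    by (simp only: rel sum_subtractf)
  have d1: "d + 1 = length \<alpha> - 1" "d + 1 = length \<beta> - 1" "d + 1 = length ?\<nu> - 1" using len by auto
  have "(\<Sum>j\<le>M. \<Sum>m\<le>M. cnt [(False, d + 1), (True, j), (True, m)] (young_level ?\<nu> 0)) =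
      int (card (two_strips (omit (\<lambda>_. 0) ?\<nu> (Suc d))))"
    using sum_cnt_level_omit_pairs[OF antitone_zero \<nu>(1,2) M(3), folded d1] unfolding om
    by (simp del: cnt.simps append_Cons)
  then have "int (card (two_strips (omit (\<lambda>_. 0) ?\<nu> (Suc d)))) =
      (\<Sum>r\<in>omittable (ribbon_start \<alpha>) \<alpha>. int (card (two_strips (omit (ribbon_start \<alpha>) \<alpha> r)))) -
      (\<Sum>r\<in>omittable (ribbon_start \<beta>) \<beta>. int (card (two_strips (omit (ribbon_start \<beta>) \<beta> r))))"
    using S[of "[]"] sum_cnt_level_omit_pairs[OF antitone_ribbon_start comp(1) ne(1) M(1), folded d1]
      sum_cnt_level_omit_pairs[OF antitone_ribbon_start comp(2) ne(2) M(2), folded d1]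
    by (simp only: append_Nil)
  then have "real_of_int (int (2 * (a - b + 1))) =
      real_of_int ((\<Sum>r\<in>omittable (ribbon_start \<alpha>) \<alpha>. int (card (two_strips (omit (ribbon_start \<alpha>) \<alpha> r)))) -
      (\<Sum>r\<in>omittable (ribbon_start \<beta>) \<beta>. int (card (two_strips (omit (ribbon_start \<beta>) \<beta> r)))))"
    unfolding card_two_strips_omit_young[OF ab] by (rule arg_cong)
  then show "real (prod_list \<alpha>) * (real (d + 2) + 1 / real (hd \<alpha>) + 1 / real (last \<alpha>) - (\<Sum>x\<leftarrow>\<alpha>. 1 / real x))
    - real (prod_list \<beta>) * (real (d + 2) + 1 / real (hd \<beta>) + 1 / real (last \<beta>) - (\<Sum>x\<leftarrow>\<beta>. 1 / real x))
    = 2 * (real a - real b + 1)"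
    using sum_card_two_strips_omit_ribbon[OF comp(1) ne(1)] sum_card_two_strips_omit_ribbon[OF comp(2) ne(2)]
      ab len by (simp add: of_nat_diff)
  have M': "card (omit (\<lambda>_. 0) ?\<nu> (Suc d)) \<le> M" using card_omit_le[of "\<lambda>_. 0" ?\<nu> "Suc d"] M(3) by linarith
  have "(\<Sum>j\<le>M. \<Sum>m\<le>M. cnt ((False, d + 1) # [(False, 3)] @ [(True, j), (True, m)]) (young_level ?\<nu> 0)) = int (a - b + 1)"
    using sum_cnt_level_omit[OF antitone_zero \<nu>(1,2), where M = M and u = "[(False, 3)]", folded d1]
      sum_cnt_omit_young[OF ab M'] unfolding om by (simp del: cnt.simps)
  moreover have "(\<Sum>j\<le>M. \<Sum>m\<le>M. cnt ((False, d + 1) # [(False, 3)] @ [(True, j), (True, m)]) (ribbon_level \<alpha> 0)) =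
      (if parts_above \<alpha> 1 = 2 then int (one_blocks \<alpha> * prod_list (map (\<lambda>x. Suc (x - 2)) \<alpha>)) else 0)"
    using sum_cnt_level_omit[OF antitone_ribbon_start comp(1) ne(1), where M = M and u = "[(False, 3)]", folded d1]
      sum_omittable_cnt_ribbon[OF comp(1) two(1) M(1)] by (simp only: append_Cons append_Nil)
  moreover have "(\<Sum>j\<le>M. \<Sum>m\<le>M. cnt ((False, d + 1) # [(False, 3)] @ [(True, j), (True, m)]) (ribbon_level \<beta> 0)) =
      (if parts_above \<beta> 1 = 2 then int (one_blocks \<beta> * prod_list (map (\<lambda>x. Suc (x - 2)) \<beta>)) else 0)"
    using sum_cnt_level_omit[OF antitone_ribbon_start comp(2) ne(2), where M = M and u = "[(False, 3)]", folded d1]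
      sum_omittable_cnt_ribbon[OF comp(2) two(2) M(2)] by (simp only: append_Cons append_Nil)
  ultimately show "(if parts_above \<alpha> 1 = 2 then int (one_blocks \<alpha> * prod_list (map (\<lambda>x. Suc (x - 2)) \<alpha>)) else 0)
    - (if parts_above \<beta> 1 = 2 then int (one_blocks \<beta> * prod_list (map (\<lambda>x. Suc (x - 2)) \<beta>)) else 0)
    = int (a - b + 1)"
    using S[of "[(False, 3)]"] by simp
qed

section \<open>The ends of the two compositions\<close>

lemma add_mset_eq_replicate_mset:
  "add_mset x M = replicate_mset n y \<longleftrightarrow> x = y \<and> (\<exists>n'. n = Suc n' \<and> M = replicate_mset n' y)"
proof
  assume *: "add_mset x M = replicate_mset n y"
  then have "x \<in># replicate_mset n y" by (metis union_single_eq_member)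
  then have "x = y" "n \<noteq> 0" by (auto split: if_splits)
  then show "x = y \<and> (\<exists>n'. n = Suc n' \<and> M = replicate_mset n' y)" using * by (cases n) auto
qed auto

lemma add_mset_eq_add_replicate_mset:
  assumes "add_mset x M = add_mset p (replicate_mset n y)"
  shows "x = p \<and> M = replicate_mset n y \<or> x = y \<and> (\<exists>n'. n = Suc n' \<and> M = add_mset p (replicate_mset n' y))"
proof -
  consider "x = p" "M = replicate_mset n y"
    | K where "M = add_mset p K" "replicate_mset n y = add_mset x K"
    using assms unfolding add_eq_conv_ex by blast
  then show ?thesis
  proof cases
    case 2
    then show ?thesis using add_mset_eq_replicate_mset[of x K n y] by auto
  qed blast
qed

lemma add_mset_eq_add_add_replicate_mset:
  assumes "add_mset x M = add_mset p (add_mset q (replicate_mset n y))"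
  shows "x = p \<and> M = add_mset q (replicate_mset n y) \<or> x = q \<and> M = add_mset p (replicate_mset n y) \<or>
    x = y \<and> (\<exists>n'. n = Suc n' \<and> M = add_mset p (add_mset q (replicate_mset n' y)))"
proof -
  consider "x = p" "M = add_mset q (replicate_mset n y)"
    | K where "M = add_mset p K" "add_mset x K = add_mset q (replicate_mset n y)"
    using assms unfolding add_eq_conv_ex[of x M] by metis
  then show ?thesis
  proof cases
    case 2
    then show ?thesis using add_mset_eq_add_replicate_mset[OF 2(2)] by blast
  qed blast
qed

lemma replicate_mset_eq_mset: "mset m = replicate_mset d y \<longleftrightarrow> m = replicate d y"
proof
  assume *: "mset m = replicate_mset d y"
  have "length m = d" using arg_cong[OF *, of size] by simp
  moreover have "\<forall>x\<in>set m. x = y" using arg_cong[OF *, of set_mset] by (auto split: if_splits)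
  ultimately show "m = replicate d y" by (metis replicate_length_same)
qed simp

lemma mset_eq_add_replicate:
  assumes "mset m = add_mset p (replicate_mset e y)"
  obtains j k where "m = replicate j y @ [p] @ replicate k y" "j + k = e"
proof -
  have "p \<in> set m" using assms by (metis set_mset_mset union_single_eq_member add_mset_add_single insert_iff set_mset_add_mset_insert)
  then obtain u v where m: "m = u @ p # v" by (meson split_list)
  then have uv: "mset (u @ v) = replicate_mset e y" using assms by simp
  have "u @ v = replicate e y" using uv by (simp only: replicate_mset_eq_mset)
  then have "u = replicate (length u) y" "v = replicate (length v) y" "length u + length v = e"
    by (metis append_eq_conv_conj take_replicate min_def length_append length_replicate le_add1,
        metis append_eq_conv_conj drop_replicate length_replicate length_append diff_add_inverse,
        metis length_append length_replicate)
  then show ?thesis using that[of "length u" "length v"] m by simp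
qed

text \<open>The index i records which parts stand at the ends, for the later arithmetic. The clause
  on q = 1 in the last case is meant for c = 1 in \<beta>: the part q is then one of the ones, and
  only p is distinguished inside.\<close>

lemma ends_cases:
  fixes p q :: nat
  assumes "mset x = mset ([p, q] @ replicate d 1)"
  obtains h m l and i :: nat where "x = h # m @ [l]"
    "i = 1 \<and> (h = p \<and> l = q \<or> h = q \<and> l = p) \<and> m = replicate d 1 \<or>
     i = 2 \<and> (h = p \<and> l = 1 \<or> h = 1 \<and> l = p) \<and> (\<exists>j k. m = replicate j 1 @ [q] @ replicate k 1 \<and> Suc (j + k) = d) \<or>
     i = 3 \<and> (h = q \<and> l = 1 \<or> h = 1 \<and> l = q) \<and> (\<exists>j k. m = replicate j 1 @ [p] @ replicate k 1 \<and> Suc (j + k) = d) \<or>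
     i = 4 \<and> h = 1 \<and> l = 1 \<and> (q = 1 \<longrightarrow> (\<exists>j k. m = replicate j 1 @ [p] @ replicate k 1 \<and> Suc (j + k) = d))"
proof -
  have "length x = d + 2" using arg_cong[OF assms(1), of size] by simp
  then obtain h y where "x = h # y" "length y = Suc d" by (cases x) auto
  moreover from this have "y \<noteq> []" by auto
  ultimately obtain m l where x: "x = h # m @ [l]" by (metis append_butlast_last_id)
  have eq: "add_mset h (add_mset l (mset m)) = add_mset p (add_mset q (replicate_mset d 1))"
    using assms(1) by (simp add: x)
  have C: "(h = p \<and> l = q \<or> h = q \<and> l = p) \<and> mset m = replicate_mset d 1 \<or>
     (h = p \<and> l = 1 \<or> h = 1 \<and> l = p) \<and> (\<exists>e. mset m = add_mset q (replicate_mset e 1) \<and> Suc e = d) \<or>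
     (h = q \<and> l = 1 \<or> h = 1 \<and> l = q) \<and> (\<exists>e. mset m = add_mset p (replicate_mset e 1) \<and> Suc e = d) \<or>
     h = 1 \<and> l = 1 \<and> (\<exists>e. mset m = add_mset p (add_mset q (replicate_mset e 1)) \<and> Suc (Suc e) = d)"
    (is "?C1 \<or> ?C2 \<or> ?C3 \<or> ?C4")
  proof -
    consider "h = p" "add_mset l (mset m) = add_mset q (replicate_mset d 1)"
      | "h = q" "add_mset l (mset m) = add_mset p (replicate_mset d 1)"
      | e where "h = 1" "d = Suc e" "add_mset l (mset m) = add_mset p (add_mset q (replicate_mset e 1))"
      using add_mset_eq_add_add_replicate_mset[OF eq] by blast
    then show ?thesis
    proof cases
      case 1
      then show ?thesis using add_mset_eq_add_replicate_mset[OF 1(2)] by auto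
    next
      case 2
      then show ?thesis using add_mset_eq_add_replicate_mset[OF 2(2)] by auto
    next
      case 3
      then show ?thesis using add_mset_eq_add_add_replicate_mset[OF 3(3)] by auto
    qed
  qed
  have R: "\<exists>j k. m = replicate j 1 @ [z] @ replicate k 1 \<and> Suc (j + k) = d"
    if "\<exists>e. mset m = add_mset z (replicate_mset e 1) \<and> Suc e = d" for z
    using that by (metis mset_eq_add_replicate)
  have R4: "\<exists>e. mset m = add_mset p (replicate_mset e 1) \<and> Suc e = d"
    if "\<exists>e. mset m = add_mset p (add_mset q (replicate_mset e 1)) \<and> Suc (Suc e) = d" "q = 1"
    using that by (metis replicate_mset_Suc)
  from C show ?thesis
  proof (elim disjE)
    assume ?C1
    then show ?thesis using that[OF x, of 1] by (simp add: replicate_mset_eq_mset)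
  next
    assume ?C2
    then show ?thesis using that[OF x, of 2] R[of q] by simp
  next
    assume ?C3
    then show ?thesis using that[OF x, of 3] R[of p] by simp
  next
    assume ?C4
    moreover from this have "q = 1 \<longrightarrow> (\<exists>j k. m = replicate j 1 @ [p] @ replicate k 1 \<and> Suc (j + k) = d)"
      using R[of p] R4 by blast
    ultimately show ?thesis using that[OF x, of 4] by simp
  qed
qed

lemma one_blocks_replicate:
  "one_blocks (replicate j 1 @ ys) =
    (if j = 0 then 0 else if ys = [] \<or> 2 \<le> hd ys then 1 else 0) + one_blocks ys"
proof (induction j)
  case (Suc j)
  then show ?case by (cases j) auto
qed simp

text \<open>Multiplied out, the left side is a + b, b(a + 1), a(b + 1) or 2ab, the right side a + b,
  c(a + 2), (a + 1)b or 2(a + 1)c; only the listed coincidences occur. For c = 1 the part c is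
  itself a 1, so the cases 1 and 2 of k merge, and so do 3 and 4.\<close>

lemma end_values:
  fixes a b c e i k :: nat and x y :: real
  assumes b_def: "b = c + 1" and a_def: "a = c + 1 + e"
    and "1 \<le> c" and eq: "real (a * b) * x = real ((a + 1) * c) * y"
    and x: "i = 1 \<and> x = 1 / a + 1 / b \<or> i = 2 \<and> x = 1 / a + 1 \<or> i = 3 \<and> x = 1 / b + 1 \<or> i = 4 \<and> x = 2"
    and y: "k = 1 \<and> y = 1 / (a + 1) + 1 / c \<or> k = 2 \<and> y = 1 / (a + 1) + 1 \<or> k = 3 \<and> y = 1 / c + 1 \<or> k = 4 \<and> y = 2"
  shows "i = 1 \<and> (k = 1 \<or> c = 1 \<and> k = 2) \<or> (i = 2 \<or> e = 0 \<and> i = 3) \<and> (k = 3 \<or> c = 1 \<and> k = 4)"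
proof -
  \<comment> \<open>In terms of e and f all sides are polynomials without subtraction, which can be
    compared term by term.\<close>
  obtain f where f: "c = Suc f" using \<open>1 \<le> c\<close> by (cases c) auto
  define X where "X = real (a * b) * x"
  define Y where "Y = real ((a + 1) * c) * y"
  have XY: "X = Y" using eq by (simp add: X_def Y_def)
  have pos: "0 < real a" "0 < real b" "0 < real c" using \<open>1 \<le> c\<close> by (simp_all add: a_def b_def)
  have EX: "real (a * b) * (1 / a + 1 / b) = real (a + b)" "real (a * b) * (1 / a + 1) = real (b * (a + 1))"
    "real (a * b) * (1 / b + 1) = real (a * (b + 1))" "real (a * b) * 2 = real (2 * a * b)"
    using pos by (simp_all add: field_simps)
  have g: "u * v * (1 / u + 1 / v) = u + v" if "0 < u" "0 < v" for u v :: real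
    using that by (simp add: field_simps)
  have EY: "real ((a + 1) * c) * (1 / (a + 1) + 1 / c) = real (a + 1 + c)"
    using g[of "real (a + 1)" "real c"] pos by (simp only: of_nat_mult of_nat_add of_nat_1)
  have EY': "real ((a + 1) * c) * (1 / (a + 1) + 1) = real (c * (a + 2))"
    "real ((a + 1) * c) * (1 / c + 1) = real ((a + 1) * (c + 1))"
    "real ((a + 1) * c) * 2 = real (2 * (a + 1) * c)"
    using pos by (simp_all add: field_simps)
  have bc: "a + 1 + c = a + b" "c + 1 = b" by (simp_all add: b_def)
  have X1: "x = 1 / a + 1 / b \<Longrightarrow> X = real (a + b)"
    and X2: "x = 1 / a + 1 \<Longrightarrow> X = real (b * (a + 1))"
    and X3: "x = 1 / b + 1 \<Longrightarrow> X = real (a * (b + 1))"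
    and X4: "x = 2 \<Longrightarrow> X = real (2 * a * b)"
    unfolding X_def by (simp_all only: EX)
  have Y1: "y = 1 / (a + 1) + 1 / c \<Longrightarrow> Y = real (a + b)"
    and Y2: "y = 1 / (a + 1) + 1 \<Longrightarrow> Y = real (c * (a + 2))"
    and Y3: "y = 1 / c + 1 \<Longrightarrow> Y = real ((a + 1) * b)"
    and Y4: "y = 2 \<Longrightarrow> Y = real (2 * (a + 1) * c)"
    unfolding Y_def by (simp_all only: EY EY' bc)
  have Y: "k = 1 \<and> Y = real (a + b) \<or> k = 2 \<and> Y = real (c * (a + 2)) \<or>
      k = 3 \<and> Y = real ((a + 1) * b) \<or> k = 4 \<and> Y = real (2 * (a + 1) * c)"
    using y Y1 Y2 Y3 Y4 by blast
  consider "i = 1" "Y = real (a + b)" | "i = 2" "Y = real (b * (a + 1))"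
    | "i = 3" "Y = real (a * (b + 1))" | "i = 4" "Y = real (2 * a * b)"
    using x X1 X2 X3 X4 unfolding XY by blast
  then show ?thesis
  proof cases
    case 1
    have "c = 1" if "a + b = c * (a + 2)"
      using that by (simp add: a_def b_def f algebra_simps)
    moreover have "a + b \<noteq> (a + 1) * b" "a + b \<noteq> 2 * (a + 1) * c"
      by (simp_all add: a_def b_def f algebra_simps)
    ultimately show ?thesis using Y 1(1) unfolding 1(2) of_nat_eq_iff by blast
  next
    case 2
    have "c = 1" if "b * (a + 1) = 2 * (a + 1) * c"
      using that by (simp add: a_def b_def f algebra_simps)
    moreover have "b * (a + 1) \<noteq> a + b" "b * (a + 1) \<noteq> c * (a + 2)"
      by (simp_all add: a_def b_def f algebra_simps)
    ultimately show ?thesis using Y 2(1) unfolding 2(2) of_nat_eq_iff by blast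
  next
    case 3
    have "e = 0" if "a * (b + 1) = (a + 1) * b"
      using that by (simp add: a_def b_def f algebra_simps)
    moreover have "c = 1 \<and> e = 0" if "a * (b + 1) = 2 * (a + 1) * c"
      using that by (cases f) (simp_all add: a_def b_def f algebra_simps)
    moreover have "a * (b + 1) \<noteq> a + b" "a * (b + 1) \<noteq> c * (a + 2)"
      by (simp_all add: a_def b_def f algebra_simps)
    ultimately show ?thesis using Y 3(1) unfolding 3(2) of_nat_eq_iff by blast
  next
    case 4
    have "2 * a * b \<noteq> a + b" "2 * a * b \<noteq> c * (a + 2)" "2 * a * b \<noteq> (a + 1) * b" "2 * a * b \<noteq> 2 * (a + 1) * c"
      by (simp_all add: a_def b_def f algebra_simps)
    then show ?thesis using Y 4(1) unfolding 4(2) of_nat_eq_iff by blast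
  qed
qed

text \<open>With W = (f + 2 + e)f and g = e + 1 the product on the left is W + g, so the equation
  says (n - n')W + (n - 1)g = 0. As g is positive, n = 2 is impossible, and n = 1 leaves W = 0 or n'
  = 1.\<close>

lemma block_counts:
  fixes f e n n' :: nat
  assumes "n * ((f + 1 + e) * (f + 1)) = n' * ((f + 2 + e) * f) + e + 1" "n \<in> {1, 2}" "n' \<in> {1, 2}"
  shows "n = 1 \<and> (f = 0 \<or> n' = 1)"
  using assms by (auto simp: algebra_simps)

text \<open>For \<open>b = 2\<close> the counts above do not locate the part \<open>a + 1\<close> of \<open>\<beta>\<close>. It is located by the
  entries \<open>1, \<dots>, d\<close> alone: they fill the ribbon of \<open>\<beta>\<close> if both of its long columns have at most
  \<open>d\<close> cells, but they never fill the ribbon of \<open>\<alpha>\<close>, which has a column of \<open>d + 1\<close> cells.\<close>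

lemma ssyt_column_bound:
  assumes "T \<in> ssyt D" "\<And>r. r \<le> n \<Longrightarrow> (r0 + r, c) \<in> D"
  shows "n < T (r0 + n, c)"
  using assms(2)
proof (induction n)
  case 0
  then show ?case using assms(1) by (fastforce simp: ssyt_def PiE_iff)
next
  case (Suc n)
  then have "n < T (r0 + n, c)" by simp
  moreover have "T (r0 + n, c) < T (r0 + Suc n, c)"
    using Suc(2)[of n] Suc(2)[of "Suc n"] assms(1) by (auto simp: ssyt_def)
  ultimately show ?case by linarith
qed

lemma ribbon_start_hook:
  assumes "r < Suc (j + k)"
  shows "ribbon_start (replicate j 1 @ [p] @ replicate k 1) r = (if r < j then p - 1 else 0)"
proof -
  let ?x = "replicate j 1 @ [p] @ replicate k 1"
  have "?x ! i - 1 = (if i = j then p - 1 else 0)" if "i < Suc (j + k)" for i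
    using that by (auto simp: nth_append nth_Cons')
  then have "ribbon_start ?x r = (\<Sum>i\<in>{r<..<Suc (j + k)}. if i = j then p - 1 else 0)"
    unfolding ribbon_start_def by (intro sum.cong) auto
  also have "\<dots> = (if r < j then p - 1 else 0)" by (simp add: sum.delta)
  finally show ?thesis .
qed

lemma hook_ribbon_tableau:
  assumes "2 \<le> p" "j < d" "k < d"
  obtains T where "T \<in> ssyt (ribbon_diagram (replicate j 1 @ [p] @ replicate k 1))"
    "\<And>c. c \<in> ribbon_diagram (replicate j 1 @ [p] @ replicate k 1) \<Longrightarrow> T c \<le> d"
proof -
  define D where "D = ribbon_diagram (replicate j 1 @ [p] @ replicate k 1)"
  \<comment> \<open>Both long columns, of j + 1 and k + 1 cells, are filled with 1, 2, ... from the
    top. The row of p holds the bottom of the upper column and the top of the lower one, which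
    differ since p \<ge> 2.\<close>
  define T where "T = (\<lambda>(r, c)\<in>D. if r < j then r + 1 else if r = j then (if c = p - 1 then j + 1 else 1) else r - j + 1)"
  have D: "(r, c) \<in> D \<longleftrightarrow> r < Suc (j + k) \<and> (if r < j then c = p - 1 else if r = j then c < p else c = 0)" for r c
    using assms(1) by (auto simp: D_def ribbon_diagram_def ribbon_start_hook[unfolded One_nat_def] nth_append nth_Cons' simp del: append_Cons append_Nil split: if_splits)
  have "T \<in> D \<rightarrow>\<^sub>E {1..}" by (auto simp: T_def)
  moreover have "T (i, c) \<le> T (i, c')" if "(i, c) \<in> D" "(i, c') \<in> D" "c < c'" for i c c'
    using that by (auto simp: T_def D split: if_splits)
  moreover have "T (i, c) < T (i', c)" if "(i, c) \<in> D" "(i', c) \<in> D" "i < i'" for i i' c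
    using that assms(1) by (auto simp: T_def D split: if_splits)
  ultimately have TD: "T \<in> ssyt D" by (simp add: ssyt_def)
  have "T c \<le> d" if "c \<in> D" for c
    using that assms by (cases c) (auto simp: T_def D split: if_splits)
  with TD show ?thesis unfolding D_def by (rule that)
qed

text \<open>Schur coefficients are nonnegative, so every monomial of the subtracted ribbon occurs in
  that of \<alpha>; the content of a tableau with entries up to d cannot, since the given column of
  \<alpha> needs an entry above d.\<close>

lemma hook_ribbon_columns:
  assumes rel: "ribbon_schur \<alpha> - ribbon_schur (replicate j 1 @ [p] @ replicate k 1) = schur \<nu>"
    and "2 \<le> p" and col: "\<And>r. r \<le> d \<Longrightarrow> (r0 + r, c) \<in> ribbon_diagram \<alpha>"
  shows "d \<le> j \<or> d \<le> k"
proof (rule ccontr)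
  assume neg: "\<not> ?thesis"
  let ?D = "ribbon_diagram (replicate j 1 @ [p] @ replicate k 1)"
  obtain T where T: "T \<in> ssyt ?D" "\<And>c. c \<in> ?D \<Longrightarrow> T c \<le> d"
    using hook_ribbon_tableau[of p j d k] \<open>2 \<le> p\<close> neg by (auto simp: not_le)
  define e where "e = tableau_content ?D T"
  have "finite {T \<in> ssyt ?D. tableau_content ?D T = e}"
    by (rule finite_tableaux_with_content[OF finite_ribbon_diagram])
  moreover have "T \<in> {T \<in> ssyt ?D. tableau_content ?D T = e}" using T by (simp add: e_def)
  ultimately have "0 < card {T \<in> ssyt ?D. tableau_content ?D T = e}" unfolding card_gt_0_iff by blast
  then have "0 < tableau_series ?D e" by (simp add: tableau_series_def)
  moreover have "0 \<le> schur \<nu> e" by (simp add: schur_def tableau_series_def)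
  ultimately have "0 < tableau_series (ribbon_diagram \<alpha>) e"
    using fun_cong[OF rel, of e] by (simp add: ribbon_schur_def)
  then have "card {T \<in> ssyt (ribbon_diagram \<alpha>). tableau_content (ribbon_diagram \<alpha>) T = e} \<noteq> 0"
    by (simp add: tableau_series_def)
  then obtain T' where T': "T' \<in> ssyt (ribbon_diagram \<alpha>)" "tableau_content (ribbon_diagram \<alpha>) T' = e"
    unfolding card_eq_0_iff by blast
  let ?v = "T' (r0 + d, c)"
  have "d < ?v" using ssyt_column_bound[OF T'(1) col] .
  have "(r0 + d, c) \<in> {x \<in> ribbon_diagram \<alpha>. T' x = ?v}" using col by simp
  moreover have "finite {x \<in> ribbon_diagram \<alpha>. T' x = ?v}" using finite_ribbon_diagram by simp
  ultimately have "card {x \<in> ribbon_diagram \<alpha>. T' x = ?v} \<noteq> 0" unfolding card_eq_0_iff by blast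
  then have nz: "e ?v \<noteq> 0" unfolding T'(2)[symmetric] tableau_content_def .
  have "{x \<in> ?D. T x = ?v} = {}" using T(2) \<open>d < ?v\<close> by force
  then have "e ?v = 0" unfolding e_def tableau_content_def by (simp only: card.empty)
  then show False using nz by simp
qed

text \<open>The column consists of the first cell of the part b and the d ones below it.\<close>

lemma first_column_two_rows:
  assumes "r \<le> d" "0 < b"
  shows "(1 + r, 0) \<in> ribbon_diagram ([a, b] @ replicate d 1)"
proof -
  define x where "x = [a, b] @ replicate d 1"
  have nth: "x ! i = (if i = 0 then a else if i = 1 then b else 1)" if "i < Suc (Suc d)" for i
    unfolding x_def by (rule young_nth[OF that])
  have len: "length x = Suc (Suc d)" by (simp add: x_def)
  have "ribbon_start x (1 + r) = (\<Sum>i\<in>{1 + r<..<Suc (Suc d)}. 0)"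
    unfolding ribbon_start_def len by (rule sum.cong) (auto simp: nth)
  then show ?thesis
    using assms nth[of "1 + r"] len unfolding x_def[symmetric] ribbon_diagram_def by (auto split: if_splits)
qed

text \<open>For the reversed ribbon the ones stand above the last cell of the second part; that part
  is 2, so its row starts in column a - 1 and ends in column a.\<close>

lemma last_column_two_rows:
  assumes "r \<le> d" "0 < a"
  shows "(r, a) \<in> ribbon_diagram (rev ([a, 2] @ replicate d 1))"
proof -
  define x where "x = rev ([a, 2] @ replicate d 1)"
  have len: "length x = Suc (Suc d)" by (simp add: x_def)
  have nth: "x ! i = (if i < d then 1 else if i = d then 2 else a)" if "i < Suc (Suc d)" for i
    using that by (auto simp: x_def nth_append nth_Cons')
  have "ribbon_start x r = (\<Sum>i\<in>{r<..<Suc (Suc d)}. (if i = d then 1 else 0) + (if i = Suc d then a - 1 else 0))"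
    unfolding ribbon_start_def len by (rule sum.cong) (auto simp: nth)
  also have "\<dots> = (if r < d then 1 else 0) + (a - 1)"
    using assms(1) by (simp add: sum.distrib sum.delta)
  finally show ?thesis
    using assms nth[of r] len unfolding x_def[symmetric] ribbon_diagram_def by (auto split: if_splits)
qed

lemma parts_above_mset: "parts_above x k = size {#y \<in># mset x. k < y#}"
  by (induction x) auto

lemma prod_list_map_mset: "prod_list (map f x) = (\<Prod>y\<in>#mset x. f y)" for f :: "'a \<Rightarrow> nat"
  by (induction x) auto

lemma sum_list_map_mset: "sum_list (map f x) = (\<Sum>y\<in>#mset x. f y)" for f :: "'a \<Rightarrow> real"
  by (induction x) auto

text \<open>The 1 at one end always belongs to a block. A second block exists exactly if there are
  ones between p and q, so a single block means that the two are adjacent.\<close>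

lemma end_block:
  fixes p q :: nat
  assumes x: "x = h # (replicate j 1 @ [q] @ replicate k 1) @ [l]"
    and hl: "h = p \<and> l = 1 \<or> h = 1 \<and> l = p" and jk: "Suc (j + k) = d" and "2 \<le> p" "2 \<le> q"
  shows "one_blocks x \<in> {1, 2}"
    and "one_blocks x = 1 \<Longrightarrow> x = [p, q] @ replicate d 1 \<or> rev x = [p, q] @ replicate d 1"
proof -
  have 1: "one_blocks (replicate k 1 @ [l]) = (if l = 1 then 1 else if k = 0 then 0 else 1)"
    using hl assms(4) by (cases "l = 1") (auto simp: one_blocks_replicate[unfolded One_nat_def])
  have 2: "one_blocks x = (if h = 1 then 1 else if j = 0 then 0 else 1) + one_blocks (replicate k 1 @ [l])"
    using hl assms(4,5) unfolding x by (cases j) (auto simp: one_blocks_replicate[unfolded One_nat_def])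
  show "one_blocks x \<in> {1, 2}" using 1 2 hl assms(4) by auto
  assume "one_blocks x = 1"
  then have "h = p \<and> l = 1 \<and> j = 0 \<or> h = 1 \<and> l = p \<and> k = 0"
    using 1 2 hl assms(4) by (auto split: if_splits)
  then show "x = [p, q] @ replicate d 1 \<or> rev x = [p, q] @ replicate d 1"
    using jk unfolding x by (auto simp: replicate_append_same)
qed

section \<open>The two families\<close>

theorem theorem3p9:
  fixes \<alpha> \<beta> \<nu> :: "nat list" and R N :: nat
  assumes "composition \<alpha>" and "length \<alpha> = R" and "sum_list \<alpha> = N"
    and "composition \<beta>" and "length \<beta> = R" and "sum_list \<beta> = N"
    and "\<alpha> \<noteq> replicate R 1"
    and "int_partition \<nu>" and "sum_list \<nu> = N"
    and "ribbon_schur \<alpha> - ribbon_schur \<beta> = schur \<nu>"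
    and "sorted_parts \<alpha> \<noteq> sorted_parts \<beta>"
  shows "\<exists>a b d :: nat. \<nu> = [a, b] @ replicate d 1 \<and>
    (\<exists>\<alpha>' \<in> {\<alpha>, rev \<alpha>}. \<exists>\<beta>' \<in> {\<beta>, rev \<beta>}.
      (\<alpha>' = [b] @ replicate d 1 @ [a] \<and> \<beta>' = [b - 1] @ replicate d 1 @ [a + 1]) \<or>
      (\<alpha>' = [a, b] @ replicate d 1 \<and> \<beta>' = [b - 1, a + 1] @ replicate d 1))"
proof -
  have "cnt w (ribbon_diagram \<alpha>) - cnt w (ribbon_diagram \<beta>) = cnt w (young_diagram \<nu>)" for w
    using assms(10) unfolding ribbon_schur_def schur_def
    by (rule cnt_relation[OF finite_ribbon_diagram finite_ribbon_diagram finite_young_diagram])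
  then have rel: "level_relation \<alpha> \<beta> \<nu> 0"
    by (simp add: level_relation_def ribbon_diagram_level young_diagram_level)
  have ne: "mset \<alpha> \<noteq> mset \<beta>"
  proof
    assume "mset \<alpha> = mset \<beta>"
    then have "sort \<alpha> = sort \<beta>" by (metis mset_sort properties_for_sort sorted_sort)
    then show False using assms(11) by (simp add: sorted_parts_def)
  qed
  have eqs: "length \<alpha> = length \<beta>" "sum_list \<alpha> = sum_list \<nu>" "sum_list \<beta> = sum_list \<nu>"
    using assms by simp_all
  obtain a b d where b2: "2 \<le> b" and ba: "b \<le> a" and \<nu>: "\<nu> = [a, b] @ replicate d 1"
    and ma: "mset \<alpha> = mset ([a, b] @ replicate d 1)"
    and mb: "mset \<beta> = mset ([a + 1, b - 1] @ replicate d 1)"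
    by (rule parts_of_ribbons[OF assms(1,4,8) eqs rel ne])
  define c where "c = b - 1"
  define e where "e = a - b"
  have c1: "1 \<le> c" and bc: "b = c + 1" "a = c + 1 + e" using b2 ba by (auto simp: c_def e_def)
  obtain h m l i where \<alpha>: "\<alpha> = h # m @ [l]" and A:
    "i = 1 \<and> (h = a \<and> l = b \<or> h = b \<and> l = a) \<and> m = replicate d 1 \<or>
     i = 2 \<and> (h = a \<and> l = 1 \<or> h = 1 \<and> l = a) \<and> (\<exists>j k. m = replicate j 1 @ [b] @ replicate k 1 \<and> Suc (j + k) = d) \<or>
     i = 3 \<and> (h = b \<and> l = 1 \<or> h = 1 \<and> l = b) \<and> (\<exists>j k. m = replicate j 1 @ [a] @ replicate k 1 \<and> Suc (j + k) = d) \<or>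
     i = (4::nat) \<and> h = 1 \<and> l = 1 \<and> (b = 1 \<longrightarrow> (\<exists>j k. m = replicate j 1 @ [a] @ replicate k 1 \<and> Suc (j + k) = d))"
    using ends_cases[OF ma] .
  obtain h' m' l' i' where \<beta>: "\<beta> = h' # m' @ [l']" and B:
    "i' = 1 \<and> (h' = a + 1 \<and> l' = c \<or> h' = c \<and> l' = a + 1) \<and> m' = replicate d 1 \<or>
     i' = 2 \<and> (h' = a + 1 \<and> l' = 1 \<or> h' = 1 \<and> l' = a + 1) \<and> (\<exists>j k. m' = replicate j 1 @ [c] @ replicate k 1 \<and> Suc (j + k) = d) \<or>
     i' = 3 \<and> (h' = c \<and> l' = 1 \<or> h' = 1 \<and> l' = c) \<and> (\<exists>j k. m' = replicate j 1 @ [a + 1] @ replicate k 1 \<and> Suc (j + k) = d) \<or>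
     i' = (4::nat) \<and> h' = 1 \<and> l' = 1 \<and> (c = 1 \<longrightarrow> (\<exists>j k. m' = replicate j 1 @ [a + 1] @ replicate k 1 \<and> Suc (j + k) = d))"
    using ends_cases[OF mb[folded c_def]] .
  have len: "length \<alpha> = d + 2" "length \<beta> = d + 2"
    using arg_cong[OF ma, of size] arg_cong[OF mb, of size] by simp_all
  have goal1: ?thesis if "(h = a \<and> l = b \<or> h = b \<and> l = a) \<and> m = replicate d 1"
    "(h' = a + 1 \<and> l' = c \<or> h' = c \<and> l' = a + 1) \<and> m' = replicate d 1"
  proof -
    have "\<exists>\<alpha>' \<in> {\<alpha>, rev \<alpha>}. \<alpha>' = [b] @ replicate d 1 @ [a]" using that(1) \<alpha> by auto
    moreover have "\<exists>\<beta>' \<in> {\<beta>, rev \<beta>}. \<beta>' = [b - 1] @ replicate d 1 @ [a + 1]"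
      using that(2) \<beta> unfolding c_def by auto
    ultimately show ?thesis using \<nu> by blast
  qed
  \<comment> \<open>For d = 0 both parts are ends and the multisets suffice; otherwise the row left
    out in \<nu> is a part 1, as the omission counts require.\<close>
  show ?thesis
  proof (cases "d = 0")
    case True
    then have "m = []" "m' = []" using len \<alpha> \<beta> by auto
    then have "{#h, l#} = {#a, b#}" "{#h', l'#} = {#a + 1, c#}" using ma mb True \<alpha> \<beta> by (auto simp: c_def)
    then have "h = a \<and> l = b \<or> h = b \<and> l = a" "h' = a + 1 \<and> l' = c \<or> h' = c \<and> l' = a + 1"
      by (auto simp: add_eq_conv_ex)
    then show ?thesis using goal1 True \<open>m = []\<close> \<open>m' = []\<close> by simp
  next
    case False
    then have d1: "1 \<le> d" by simp
    have pa: "parts_above \<alpha> 1 = 2" using b2 ba by (simp add: parts_above_mset ma)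
    have pb: "parts_above \<beta> 1 = (if c = 1 then 1 else 2)"
      using c1 b2 ba by (simp add: parts_above_mset mb c_def)
    note E = omit_relations[OF assms(1,4) b2 ba d1 len _ _ rel[unfolded \<nu>]]
    define x where "x = 1 / real (hd \<alpha>) + 1 / real (last \<alpha>)"
    define y where "y = 1 / real (hd \<beta>) + 1 / real (last \<beta>)"
    have "prod_list \<alpha> = a * b" "prod_list \<beta> = (a + 1) * c"
      using prod_list_map_mset[of "\<lambda>x. x" \<alpha>] prod_list_map_mset[of "\<lambda>x. x" \<beta>] by (simp_all add: ma mb c_def)
    moreover have "(\<Sum>x\<leftarrow>\<alpha>. 1 / real x) = 1 / real a + 1 / real b + real d"
      "(\<Sum>x\<leftarrow>\<beta>. 1 / real x) = 1 / real (a + 1) + 1 / real c + real d"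
      by (simp_all only: sum_list_map_mset ma mb) (simp_all add: c_def)
    ultimately have "real (a * b) * (x + 2 - 1 / real a - 1 / real b)
        - real ((a + 1) * c) * (y + 2 - 1 / real (a + 1) - 1 / real c) = 2 * (real a - real b + 1)"
      using E(1) pa pb by (simp add: x_def y_def algebra_simps)
    moreover have "real (a * b) * (1 / real a + 1 / real b) = real (a + b)"
      "real ((a + 1) * c) * (1 / real (a + 1) + 1 / real c) = real (a + 1 + c)"
      using b2 ba c1 by (simp_all add: divide_simps) (simp_all add: algebra_simps)
    \<comment> \<open>All that does not depend on the order cancels: ab - (a + 1)c = a - b + 1
      absorbs the right-hand side, and both reciprocal terms equal a + b.\<close>
    ultimately have "real (a * b) * x - real ((a + 1) * c) * y = 0"
      unfolding bc by (simp add: algebra_simps)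
    then have eq: "real (a * b) * x = real ((a + 1) * c) * y" by simp
    have x: "i = 1 \<and> x = 1 / a + 1 / b \<or> i = 2 \<and> x = 1 / a + 1 \<or> i = 3 \<and> x = 1 / b + 1 \<or> i = 4 \<and> x = 2"
      using A unfolding x_def \<alpha> by auto
    have y: "i' = 1 \<and> y = 1 / (a + 1) + 1 / c \<or> i' = 2 \<and> y = 1 / (a + 1) + 1 \<or> i' = 3 \<and> y = 1 / c + 1 \<or> i' = 4 \<and> y = 2"
      using B unfolding y_def \<beta> by auto
    from end_values[OF bc c1 eq x y] consider "i = 1" "i' = 1 \<or> c = 1 \<and> i' = 2"
      | "i = 2 \<or> e = 0 \<and> i = 3" "i' = 3 \<or> c = 1 \<and> i' = 4" by blast
    then show ?thesis
    proof cases
      case 1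
      have "(h = a \<and> l = b \<or> h = b \<and> l = a) \<and> m = replicate d 1" using A 1(1) by simp
      moreover have "(h' = a + 1 \<and> l' = c \<or> h' = c \<and> l' = a + 1) \<and> m' = replicate d 1"
        using 1(2)
      proof
        assume "i' = 1"
        then show ?thesis using B by simp
      next
        \<comment> \<open>The end 1 plays the role of c, and the c inside is one of the
          ones.\<close>
        assume *: "c = 1 \<and> i' = 2"
        then obtain j k where "m' = replicate j 1 @ [1] @ replicate k 1" "Suc (j + k) = d"
          using B by auto
        then have "m' = replicate (j + Suc k) 1" "j + Suc k = d" by (simp_all only: replicate_add replicate_Suc append_Cons append_Nil)
        then show ?thesis using * B by auto
      qed
      ultimately show ?thesis by (rule goal1)
    next
      case 2
      \<comment> \<open>If e = 0 then a = b, so the index 3 describes the same arrangement as the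
        index 2.\<close>
      obtain j k where m: "m = replicate j 1 @ [b] @ replicate k 1" "Suc (j + k) = d"
        and hl: "h = a \<and> l = 1 \<or> h = 1 \<and> l = a"
        using A 2(1) bc by auto
      obtain j' k' where m': "m' = replicate j' 1 @ [a + 1] @ replicate k' 1" "Suc (j' + k') = d"
        and hl': "h' = c \<and> l' = 1 \<or> h' = 1 \<and> l' = c"
        using B 2(2) by auto
      note blocks = end_block[OF \<alpha>[unfolded m(1)] hl m(2)]
      obtain f where f: "c = Suc f" using c1 by (cases c) auto
      \<comment> \<open>For c = 1 the block count sees nothing of \<beta>; its coefficient f
        vanishes then, and the value 1 merely keeps n' in the range of
        \<open>block_counts\<close>.\<close>
      define n' where "n' = (if c = 1 then 1 else one_blocks \<beta>)"
      note blocks' = end_block[OF \<beta>[unfolded m'(1)] hl' m'(2)]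
      have n': "n' \<in> {1, 2}" using blocks'(1) c1 b2 ba unfolding n'_def by auto
      have "prod_list (map (\<lambda>x. Suc (x - 2)) \<alpha>) = (f + 1 + e) * (f + 1)"
        by (simp only: prod_list_map_mset ma) (simp add: bc f)
      moreover have "prod_list (map (\<lambda>x. Suc (x - 2)) \<beta>) = (f + 2 + e) * f" if "c \<noteq> 1"
        using that by (simp only: prod_list_map_mset mb) (simp add: bc f)
      ultimately have "int (one_blocks \<alpha> * ((f + 1 + e) * (f + 1))) - int (n' * ((f + 2 + e) * f)) = int (e + 1)"
        using E(2) pa pb by (auto simp: n'_def f bc split: if_splits)
      then have "one_blocks \<alpha> * ((f + 1 + e) * (f + 1)) = n' * ((f + 2 + e) * f) + e + 1" by linarith
      moreover have "one_blocks \<alpha> \<in> {1, 2}" using b2 ba by (intro blocks(1)) simp_all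
      ultimately have n: "one_blocks \<alpha> = 1" "f = 0 \<or> n' = 1"
        using block_counts[OF _ _ n'] by blast+
      then have \<alpha>2: "\<alpha> = [a, b] @ replicate d 1 \<or> rev \<alpha> = [a, b] @ replicate d 1"
        using blocks(2) b2 ba by simp
      have "\<beta> = [c, a + 1] @ replicate d 1 \<or> rev \<beta> = [c, a + 1] @ replicate d 1"
      proof (cases "c = 1")
        case False
        then show ?thesis using blocks'(2) n(2) f b2 ba by (simp add: n'_def)
      next
        case True
        have "\<beta> = 1 # (replicate j' 1 @ [a + 1] @ replicate k' 1) @ [1]" using \<beta> m' hl' True by auto
        then have \<beta>': "\<beta> = replicate (Suc j') 1 @ [a + 1] @ replicate (Suc k') 1"
          by (simp add: replicate_append_same)
        \<comment> \<open>Here b = 2, and in either orientation the part 2 and the d ones provide a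
          column of d + 1 cells.\<close>
        have "\<exists>r0 c0. \<forall>r\<le>d. (r0 + r, c0) \<in> ribbon_diagram \<alpha>"
          using \<alpha>2
        proof
          assume "\<alpha> = [a, b] @ replicate d 1"
          then show ?thesis using first_column_two_rows[of _ d b a] b2 by (intro exI[of _ 1] exI[of _ 0]) auto
        next
          assume "rev \<alpha> = [a, b] @ replicate d 1"
          then have "\<alpha> = rev ([a, 2] @ replicate d 1)" using True bc by (metis rev_rev_ident one_add_one)
          then show ?thesis using last_column_two_rows[of _ d a] b2 ba by (intro exI[of _ 0] exI[of _ a]) auto
        qed
        then obtain r0 c0 where col: "\<And>r. r \<le> d \<Longrightarrow> (r0 + r, c0) \<in> ribbon_diagram \<alpha>" by blast
        have "d \<le> Suc j' \<or> d \<le> Suc k'"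
          using hook_ribbon_columns[OF assms(10)[unfolded \<beta>'] _ col] b2 ba by simp
        then have "j' = 0 \<and> Suc k' = d \<or> k' = 0 \<and> Suc j' = d" using m'(2) by auto
        then show ?thesis unfolding \<beta>' True by (auto simp: replicate_append_same)
      qed
      then have "\<exists>\<beta>' \<in> {\<beta>, rev \<beta>}. \<beta>' = [b - 1, a + 1] @ replicate d 1" by (auto simp: c_def)
      moreover have "\<exists>\<alpha>' \<in> {\<alpha>, rev \<alpha>}. \<alpha>' = [a, b] @ replicate d 1" using \<alpha>2 by auto
      ultimately show ?thesis using \<nu> by blast
    qed
  qed
qed

end
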